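(* Let $m\geq1$ be an integer, let $\Omega$ be a bounded open subset of $\mathbf{R}^N$, and let $M$ be a $\Phi$-function on $\Omega$ satisfying condition $(\mathcal{M}2)$ (defined in the context). Then there exists a constant $c_{m,\Omega}>0$ depending only on $m$ and $\Omega$ such that for every $u\in W^m_0E_M(\Omega)$ $$\int_\Omega \sum_{|\alpha|< m} M(x,|D^\alpha u(x)|)\,dx\leq \int_\Omega \sum_{|\alpha|= m} M(x,c_{m,\Omega}|D^\alpha u(x)|)\,dx,$$ and there exists a constant $C(m,\Omega)$ depending only on $m$ and $\Omega$ such that for every $u\in W^m_0E_M(\Omega)$ $$\sum_{|\alpha|< m} \|D^\alpha u\|_{M,\Omega}\leq C(m,\Omega)\sum_{|\alpha|= m} \|D^\alpha u\|_{M,\Omega}.$$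
   Context: Let $N\geq 1$ and $\mathbf{R}^+=[0,\infty)$. **$\phi$- and $\Phi$-functions.** A function $M:\Omega\times\mathbf{R}^+\to\mathbf{R}^+$ is a $\phi$-function if for all $x\in\Omega$ the function $M(x,\cdot)$ is nondecreasing and convex with $M(x,0)=0$, $M(x,s)>0$ for $s>0$, $M(x,s)\to\infty$ as $s\to\infty$, and $M(\cdot,s)$ is measurable for every $s\geq0$. It is a $\Phi$-function ($M\in\Phi$) if furthermore $\lim_{s\to0}M(x,s)/s=0$ and $\lim_{s\to\infty}M(x,s)/s=\infty$. The complementary $\Phi$-function is $M^*(x,s)=\sup_{t\geq0}\{st-M(x,t)\}$. Standing convention: $\Phi$-functions (both $M$ and $M^*$) are locally integrable, i.e. $\int_K M(x,c)\,dx<\infty$ and $\int_K M^*(x,c)\,dx<\infty$ for every constant $c>0$ and every compact $K\subset\Omega$. **Spaces.** $L_M(\Omega)$ (resp. $E_M(\Omega)$) is the set of measurable $u:\Omega\to\mathbf{R}$ with $\int_\Omega M(x,|u(x)|/\lambda)\,dx<\infty$ for some $\lambda>0$ (resp. for all $\lambda>0$), with the Luxemburg norm $\|u\|_{M,\Omega}=\inf\{\lambda>0:\int_\Omega M(x,|u(x)|/\lambda)\,dx\leq1\}$. $W^mL_M(\Omega)=\{u\in L_M(\Omega): D^\alpha u\in L_M(\Omega),\ |\alpha|\leq m\}$ and $W^mE_M(\Omega)=\{u\in E_M(\Omega): D^\alpha u\in E_M(\Omega),\ |\alpha|\leq m\}$, with distributional derivatives $D^\alpha$, $\alpha$ a multi-index,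 and norm $\|u\|_{m,M,\Omega}=\inf\{\lambda>0:\sum_{|\alpha|\leq m}\int_\Omega M(x,|D^\alpha u(x)|/\lambda)\,dx\leq1\}$. $W^m_0E_M(\Omega)$ is the norm closure in $W^mE_M(\Omega)$ of $C_0^\infty(\Omega)$ (smooth functions compactly supported in $\Omega$). **Condition $(\mathcal{M}2)$ ($Y$-condition).** There are $1\leq i\leq N$ and a segment $[a,b]\subset\mathbf{R}$ with $\Omega\subset\{x: x_i\in[a,b]\}$ such that one of the following holds, where $x_i\mapsto M(x,t)$ denotes the partial function of the $i$-th coordinate $x_i\in[a,b]$ (other coordinates fixed, $x\in\Omega$): - $(Y_0)$: there exists $t_0\in\mathbf{R}^+$ such that $x_i\mapsto M(x,t)$ changes its monotonicity on the two sides of $t_0$: either it is nondecreasing for all $t<t_0$ and nonincreasing for all $t\geq t_0$, or it is nonincreasing for all $t<t_0$ and nondecreasing for all $t\geq t_0$ (the same alternative for all values of the other coordinates); - $(Y_\infty)$: for all $t\geq0$, $x_i\mapsto M(x,t)$ is monotone on $[a,b]$, in the same direction (nondecreasing for all $t$, or nonincreasing for all $t$, and for all values of the other coordinates). *)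

theory Defs
  imports "HOL-Analysis.Analysis"
begin

section \<open>Musielak functions\<close>

text \<open>Functions on \<open>\<Omega> \<times> [0,\<infinity>)\<close> are total functions of type \<open>real^'n \<Rightarrow> real \<Rightarrow> real\<close>;
  only their values at \<open>x \<in> \<Omega>\<close>, \<open>s \<ge> 0\<close> are constrained or used.\<close>

definition phi_function :: "(real^'n) set \<Rightarrow> (real^'n \<Rightarrow> real \<Rightarrow> real) \<Rightarrow> bool" where
  "phi_function \<Omega> M \<longleftrightarrow>
     (\<forall>x\<in>\<Omega>. (\<forall>s\<ge>0. M x s \<ge> 0) \<and> mono_on {0..} (M x) \<and> convex_on {0..} (M x) \<and>
        M x 0 = 0 \<and> (\<forall>s>0. M x s > 0) \<and> filterlim (M x) at_top at_top) \<and>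
     (\<forall>s\<ge>0. (\<lambda>x. M x s) \<in> borel_measurable (lebesgue_on \<Omega>))"

definition Phi_function :: "(real^'n) set \<Rightarrow> (real^'n \<Rightarrow> real \<Rightarrow> real) \<Rightarrow> bool" where
  "Phi_function \<Omega> M \<longleftrightarrow> phi_function \<Omega> M \<and>
     (\<forall>x\<in>\<Omega>. ((\<lambda>s. M x s / s) \<longlongrightarrow> 0) (at_right 0) \<and>
        filterlim (\<lambda>s. M x s / s) at_top at_top)"

text \<open>For a \<open>\<Phi>\<close>-function the supremum is over a set that is bounded above, because \<open>M x t / t\<close>
  tends to infinity; the real-valued supremum is therefore the intended one.\<close>

definition complementary :: "(real^'n \<Rightarrow> real \<Rightarrow> real) \<Rightarrow> real^'n \<Rightarrow> real \<Rightarrow> real" where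
  "complementary M x s = (SUP t\<in>{0..}. s * t - M x t)"

definition locally_integrable :: "(real^'n) set \<Rightarrow> (real^'n \<Rightarrow> real) \<Rightarrow> bool" where
  "locally_integrable \<Omega> f \<longleftrightarrow> (\<forall>K. compact K \<and> K \<subseteq> \<Omega> \<longrightarrow> integrable (lebesgue_on K) f)"

definition Phi_locally_integrable :: "(real^'n) set \<Rightarrow> (real^'n \<Rightarrow> real \<Rightarrow> real) \<Rightarrow> bool" where
  "Phi_locally_integrable \<Omega> M \<longleftrightarrow>
     (\<forall>c>0. locally_integrable \<Omega> (\<lambda>x. M x c) \<and> locally_integrable \<Omega> (\<lambda>x. complementary M x c))"


section \<open>The Y-condition\<close>

definition upd_coord :: "real^'n \<Rightarrow> 'n \<Rightarrow> real \<Rightarrow> real^'n" where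
  "upd_coord x i r = (\<chi> j. if j = i then r else x $ j)"

text \<open>Monotonicity of the partial function \<open>r \<mapsto> f (x\<^sub>1, \<dots>, r, \<dots>, x\<^sub>N)\<close> (with \<open>r\<close> in position \<open>i\<close>)
  on the part of \<open>[a,b]\<close> where the point lies in \<open>\<Omega>\<close>, for all values of the other coordinates.\<close>

definition nondecreasing_coord ::
  "(real^'n) set \<Rightarrow> 'n \<Rightarrow> real \<Rightarrow> real \<Rightarrow> (real^'n \<Rightarrow> real) \<Rightarrow> bool" where
  "nondecreasing_coord \<Omega> i a b f \<longleftrightarrow>
     (\<forall>x. mono_on {r\<in>{a..b}. upd_coord x i r \<in> \<Omega>} (\<lambda>r. f (upd_coord x i r)))"

definition nonincreasing_coord ::
  "(real^'n) set \<Rightarrow> 'n \<Rightarrow> real \<Rightarrow> real \<Rightarrow> (real^'n \<Rightarrow> real) \<Rightarrow> bool" where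
  "nonincreasing_coord \<Omega> i a b f \<longleftrightarrow>
     (\<forall>x. antimono_on {r\<in>{a..b}. upd_coord x i r \<in> \<Omega>} (\<lambda>r. f (upd_coord x i r)))"

definition Y0_condition ::
  "(real^'n) set \<Rightarrow> 'n \<Rightarrow> real \<Rightarrow> real \<Rightarrow> (real^'n \<Rightarrow> real \<Rightarrow> real) \<Rightarrow> bool" where
  "Y0_condition \<Omega> i a b M \<longleftrightarrow> (\<exists>t0\<ge>0.
     ((\<forall>t. 0 \<le> t \<and> t < t0 \<longrightarrow> nondecreasing_coord \<Omega> i a b (\<lambda>x. M x t)) \<and>
      (\<forall>t\<ge>t0. nonincreasing_coord \<Omega> i a b (\<lambda>x. M x t))) \<or>
     ((\<forall>t. 0 \<le> t \<and> t < t0 \<longrightarrow> nonincreasing_coord \<Omega> i a b (\<lambda>x. M x t)) \<and>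
      (\<forall>t\<ge>t0. nondecreasing_coord \<Omega> i a b (\<lambda>x. M x t))))"

definition Yinf_condition ::
  "(real^'n) set \<Rightarrow> 'n \<Rightarrow> real \<Rightarrow> real \<Rightarrow> (real^'n \<Rightarrow> real \<Rightarrow> real) \<Rightarrow> bool" where
  "Yinf_condition \<Omega> i a b M \<longleftrightarrow>
     (\<forall>t\<ge>0. nondecreasing_coord \<Omega> i a b (\<lambda>x. M x t)) \<or>
     (\<forall>t\<ge>0. nonincreasing_coord \<Omega> i a b (\<lambda>x. M x t))"

definition Y_condition :: "(real^'n) set \<Rightarrow> (real^'n \<Rightarrow> real \<Rightarrow> real) \<Rightarrow> bool" where
  "Y_condition \<Omega> M \<longleftrightarrow>
     (\<exists>i a b. a \<le> b \<and> \<Omega> \<subseteq> {x. x $ i \<in> {a..b}} \<and>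
        (Y0_condition \<Omega> i a b M \<or> Yinf_condition \<Omega> i a b M))"


section \<open>Test functions and distributional derivatives\<close>

definition partial_deriv :: "'n \<Rightarrow> (real^'n \<Rightarrow> real) \<Rightarrow> real^'n \<Rightarrow> real" where
  "partial_deriv i f x = frechet_derivative f (at x) (axis i 1)"

primrec C_k :: "nat \<Rightarrow> (real^'n \<Rightarrow> real) \<Rightarrow> bool" where
  "C_k 0 f \<longleftrightarrow> continuous_on UNIV f"
| "C_k (Suc k) f \<longleftrightarrow> (\<forall>x. f differentiable (at x)) \<and> (\<forall>i. C_k k (partial_deriv i f))"

text \<open>Elements of \<open>C\<^sub>0\<^sup>\<infinity>(\<Omega>)\<close>, extended by zero to the whole space.\<close>

definition test_functions :: "(real^'n) set \<Rightarrow> (real^'n \<Rightarrow> real) set" where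
  "test_functions \<Omega> =
     {\<phi>. (\<forall>k. C_k k \<phi>) \<and> compact (closure {x. \<phi> x \<noteq> 0}) \<and> closure {x. \<phi> x \<noteq> 0} \<subseteq> \<Omega>}"

text \<open>Multi-indices are functions \<open>\<alpha> :: 'n \<Rightarrow> nat\<close>. As the index type carries no order, the
  iterated partial derivatives are taken along some fixed enumeration of the coordinates; for
  smooth functions the order is irrelevant.\<close>

definition mi_order :: "('n::finite \<Rightarrow> nat) \<Rightarrow> nat" where
  "mi_order \<alpha> = (\<Sum>i\<in>UNIV. \<alpha> i)"

definition coord_enum :: "'n::finite list" where
  "coord_enum = (SOME is. distinct is \<and> set is = UNIV)"

definition classical_deriv :: "('n \<Rightarrow> nat) \<Rightarrow> (real^'n \<Rightarrow> real) \<Rightarrow> real^'n \<Rightarrow> real" where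
  "classical_deriv \<alpha> f = foldr (\<lambda>i. partial_deriv i ^^ \<alpha> i) coord_enum f"

definition is_weak_deriv ::
  "(real^'n) set \<Rightarrow> ('n \<Rightarrow> nat) \<Rightarrow> (real^'n \<Rightarrow> real) \<Rightarrow> (real^'n \<Rightarrow> real) \<Rightarrow> bool" where
  "is_weak_deriv \<Omega> \<alpha> u v \<longleftrightarrow> locally_integrable \<Omega> u \<and> locally_integrable \<Omega> v \<and>
     (\<forall>\<phi>\<in>test_functions \<Omega>.
        (LINT x|lebesgue_on \<Omega>. u x * classical_deriv \<alpha> \<phi> x) =
        (-1) ^ mi_order \<alpha> * (LINT x|lebesgue_on \<Omega>. v x * \<phi> x))"

text \<open>A representative of the distributional derivative, which is unique up to null sets;
  meaningful whenever some locally integrable weak derivative exists.\<close>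

definition weak_deriv ::
  "(real^'n) set \<Rightarrow> ('n \<Rightarrow> nat) \<Rightarrow> (real^'n \<Rightarrow> real) \<Rightarrow> real^'n \<Rightarrow> real" where
  "weak_deriv \<Omega> \<alpha> u = (SOME v. is_weak_deriv \<Omega> \<alpha> u v)"


section \<open>Musielak-Orlicz-Sobolev spaces\<close>

text \<open>The spaces are sets of functions rather than of classes modulo almost-everywhere equality.
  The modular is \<open>\<integral>\<^sub>\<Omega> M(x, |u(x)|) dx \<in> [0,\<infinity>]\<close>.\<close>

definition modular ::
  "(real^'n) set \<Rightarrow> (real^'n \<Rightarrow> real \<Rightarrow> real) \<Rightarrow> (real^'n \<Rightarrow> real) \<Rightarrow> ennreal" where
  "modular \<Omega> M u = (\<integral>\<^sup>+x. ennreal (M x \<bar>u x\<bar>) \<partial>lebesgue_on \<Omega>)"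

definition E_space ::
  "(real^'n) set \<Rightarrow> (real^'n \<Rightarrow> real \<Rightarrow> real) \<Rightarrow> (real^'n \<Rightarrow> real) set" where
  "E_space \<Omega> M = {u. u \<in> borel_measurable (lebesgue_on \<Omega>) \<and>
     (\<forall>k>0. modular \<Omega> M (\<lambda>x. u x / k) < \<infinity>)}"

definition luxemburg_norm ::
  "(real^'n) set \<Rightarrow> (real^'n \<Rightarrow> real \<Rightarrow> real) \<Rightarrow> (real^'n \<Rightarrow> real) \<Rightarrow> real" where
  "luxemburg_norm \<Omega> M u = Inf {k. k > 0 \<and> modular \<Omega> M (\<lambda>x. u x / k) \<le> 1}"

definition WE_space ::
  "nat \<Rightarrow> (real^'n) set \<Rightarrow> (real^'n \<Rightarrow> real \<Rightarrow> real) \<Rightarrow> (real^'n \<Rightarrow> real) set" where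
  "WE_space m \<Omega> M = {u \<in> E_space \<Omega> M.
     \<forall>\<alpha>. mi_order \<alpha> \<le> m \<longrightarrow> (\<exists>v\<in>E_space \<Omega> M. is_weak_deriv \<Omega> \<alpha> u v)}"

definition sobolev_norm ::
  "nat \<Rightarrow> (real^'n) set \<Rightarrow> (real^'n \<Rightarrow> real \<Rightarrow> real) \<Rightarrow> (real^'n \<Rightarrow> real) \<Rightarrow> real" where
  "sobolev_norm m \<Omega> M u = Inf {k. k > 0 \<and>
     (\<Sum>\<alpha> | mi_order \<alpha> \<le> m. modular \<Omega> M (\<lambda>x. weak_deriv \<Omega> \<alpha> u x / k)) \<le> 1}"

text \<open>The norm closure of \<open>C\<^sub>0\<^sup>\<infinity>(\<Omega>)\<close> in \<^const>\<open>WE_space\<close>.\<close>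

definition WE0_space ::
  "nat \<Rightarrow> (real^'n) set \<Rightarrow> (real^'n \<Rightarrow> real \<Rightarrow> real) \<Rightarrow> (real^'n \<Rightarrow> real) set" where
  "WE0_space m \<Omega> M = {u \<in> WE_space m \<Omega> M.
     \<forall>\<epsilon>>0. \<exists>\<phi>\<in>test_functions \<Omega>. sobolev_norm m \<Omega> M (\<lambda>x. u x - \<phi> x) < \<epsilon>}"

end

theory Submission
  imports Defs
begin

text \<open>For a test function \<open>f\<close> and \<open>x \<in> \<Omega>\<close>, \<open>\<bar>f x\<bar>\<close> is at most the integral of \<open>\<bar>\<partial>\<^sub>i f\<bar>\<close> along
  either of the two half-lines through \<open>x\<close> in the direction of the \<open>Y\<close>-condition. Jensen's inequality
  for \<open>M x\<close> together with the monotonicity of \<open>M\<close> along that direction bounds \<open>M x \<bar>f x\<bar>\<close> by the average of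
  \<open>M z (c * \<bar>\<partial>\<^sub>i f z\<bar>)\<close> over a segment of points \<open>z\<close> around \<open>x\<close>, where one side of \<open>x\<close> is used if
  \<open>\<bar>f x\<bar>\<close> is large compared with \<open>t0\<close> and the other side if it is small. Integrating over \<open>x\<close>, Tonelli and
  translation invariance give the first-order modular inequality, which is iterated in the same
  direction. For \<open>u \<in> W\<^sup>m\<^sub>0E\<^sub>M\<close> one splits \<open>u = \<phi> + (u - \<phi>)\<close> with a test function \<open>\<phi>\<close>; the modulars of arbitrarily
  large multiples of the derivatives of \<open>u - \<phi>\<close> can be made small, so only a factor 4 in the constant
  is lost. The modular inequality at all scales yields the norm inequality.\<close>

section \<open>Calculus of smooth functions\<close>

text \<open>The obstacle is the dependence of \<open>M\<close> on \<open>x\<close>. Jensen's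
  inequality produces \<open>M x\<close> of a derivative taken at another point \<open>z\<close>,
  and \<open>M x t\<close> is bounded by \<open>M z t\<close> only for \<open>t\<close> on one side
  of \<open>t0\<close>; for the other range of \<open>t\<close> the point \<open>z\<close> must lie
  on the opposite side of \<open>x\<close>. The derivative may take values in the wrong range
  whatever the size of \<open>f x\<close>. Controlling these values raises the constant from
  \<open>L\<close>, a number exceeding all distances in \<open>\<Omega>\<close>, to
  \<open>4 * L\<close>; the sum over both half-lines costs a further factor 2, which convexity moves
  into the argument, whence \<open>8 * L\<close>. Only one coordinate \<open>i\<close> is
  controlled. A multi-index of lower order is therefore compared with the one obtained by raising
  its \<open>i\<close>-th entry until the order is \<open>m\<close>. The modular is neither
  homogeneous nor subadditive, and no doubling condition is assumed. Scalars are thus carried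
  through every estimate, and each splitting of a sum doubles the arguments. Since
  \<open>weak_deriv\<close> is defined by choice, almost everywhere uniqueness of distributional
  derivatives has to be established as well; bump functions adapted to boxes serve this
  purpose.\<close>

lemma partial_deriv_eqI:
  assumes "(f has_derivative F) (at x)"
  shows "partial_deriv i f x = F (axis i 1)"
  using frechet_derivative_at[OF assms] by (simp add: partial_deriv_def)

lemma C_k_continuous:
  fixes f :: "real^'n \<Rightarrow> real"
  shows "C_k k f \<Longrightarrow> continuous_on UNIV f"
proof (cases k)
  case (Suc l)
  assume "C_k k f"
  then have "f differentiable_on UNIV" by (simp add: Suc differentiable_on_def)
  then show ?thesis by (rule differentiable_imp_continuous_on)
qed simp

lemma C_k_mono: "C_k (Suc k) f \<Longrightarrow> C_k k f"
proof (induction k arbitrary: f)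
  case 0
  from C_k_continuous[OF this] show ?case by simp
next
  case (Suc k)
  then show ?case by (metis C_k.simps(2))
qed

lemma differentiable_has_derivative:
  "f differentiable (at x) \<Longrightarrow> (f has_derivative frechet_derivative f (at x)) (at x)"
  using frechet_derivative_works by blast

lemma partial_deriv_add:
  "f differentiable (at x) \<Longrightarrow> g differentiable (at x) \<Longrightarrow>
    partial_deriv i (\<lambda>x. f x + g x) x = partial_deriv i f x + partial_deriv i g x"
  by (subst partial_deriv_eqI[OF has_derivative_add[OF differentiable_has_derivative differentiable_has_derivative]])
     (auto simp: partial_deriv_def)

lemma partial_deriv_mult:
  fixes f g :: "real^'n \<Rightarrow> real"
  shows "f differentiable (at x) \<Longrightarrow> g differentiable (at x) \<Longrightarrow>
    partial_deriv i (\<lambda>x. f x * g x) x = f x * partial_deriv i g x + partial_deriv i f x * g x"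
  by (subst partial_deriv_eqI[OF has_derivative_mult[OF differentiable_has_derivative differentiable_has_derivative]])
     (auto simp: partial_deriv_def)

lemma partial_deriv_const: "partial_deriv i (\<lambda>x. c) = (\<lambda>x. 0)"
  by (rule ext) (auto intro!: partial_deriv_eqI[THEN trans] has_derivative_const)

lemma C_k_const: "C_k k (\<lambda>x. c)"
  by (induction k arbitrary: c) (auto simp: partial_deriv_const)

lemma C_k_add: "C_k k f \<Longrightarrow> C_k k g \<Longrightarrow> C_k k (\<lambda>x. f x + g x)"
proof (induction k arbitrary: f g)
  case 0
  then show ?case by (auto intro: continuous_intros)
next
  case (Suc k)
  have "partial_deriv i (\<lambda>x. f x + g x) = (\<lambda>x. partial_deriv i f x + partial_deriv i g x)" for i
    using Suc.prems by (intro ext partial_deriv_add) auto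
  with Suc show ?case by auto
qed

lemma C_k_mult:
  fixes f g :: "real^'n \<Rightarrow> real"
  shows "C_k k f \<Longrightarrow> C_k k g \<Longrightarrow> C_k k (\<lambda>x. f x * g x)"
proof (induction k arbitrary: f g)
  case 0
  then show ?case by (auto intro: continuous_intros)
next
  case (Suc k)
  have "partial_deriv i (\<lambda>x. f x * g x) =
    (\<lambda>x. f x * partial_deriv i g x + partial_deriv i f x * g x)" for i
    using Suc.prems by (intro ext partial_deriv_mult) auto
  moreover have "C_k k f" "C_k k g" using Suc.prems C_k_mono by blast+
  ultimately show ?case using Suc by (auto intro!: C_k_add)
qed

lemma C_k_prod: "(\<And>i. i \<in> A \<Longrightarrow> C_k k (f i)) \<Longrightarrow> C_k k (\<lambda>x. \<Prod>i\<in>A. f i x)"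
  by (induction A rule: infinite_finite_induct) (auto intro!: C_k_mult C_k_const)

lemma partial_deriv_cmult:
  "f differentiable (at x) \<Longrightarrow> partial_deriv i (\<lambda>x. c * f x) x = c * partial_deriv i f x"
  using partial_deriv_mult[of "\<lambda>_. c" x f i] by (simp add: partial_deriv_const)

definition smooth :: "(real^'n \<Rightarrow> real) \<Rightarrow> bool" where
  "smooth f \<longleftrightarrow> (\<forall>k. C_k k f)"

lemma smooth_partial_deriv: "smooth f \<Longrightarrow> smooth (partial_deriv i f)"
  unfolding smooth_def by (metis C_k.simps(2))

lemma smooth_differentiable: "smooth f \<Longrightarrow> f differentiable (at x)"
  unfolding smooth_def by (metis C_k.simps(2))

lemma smooth_continuous: "smooth f \<Longrightarrow> continuous_on UNIV f"
  unfolding smooth_def using C_k_continuous by blast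

lemma smooth_const: "smooth (\<lambda>x. c)"
  and smooth_mult: "smooth f \<Longrightarrow> smooth g \<Longrightarrow> smooth (\<lambda>x. f x * g x)"
  and smooth_prod: "(\<And>i. i \<in> A \<Longrightarrow> smooth (h i)) \<Longrightarrow> smooth (\<lambda>x. \<Prod>i\<in>A. h i x)"
  unfolding smooth_def by (auto intro: C_k_const C_k_mult C_k_prod)

lemma smooth_cmult: "smooth f \<Longrightarrow> smooth (\<lambda>x. c * f x)"
  by (intro smooth_mult smooth_const)

lemma has_real_derivative_along_axis:
  fixes f :: "real^'n \<Rightarrow> real"
  assumes "f differentiable (at (x + s *\<^sub>R axis i 1))"
  shows "((\<lambda>s. f (x + s *\<^sub>R axis i 1)) has_real_derivative
          partial_deriv i f (x + s *\<^sub>R axis i 1)) (at s within S)"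
proof -
  let ?D = "frechet_derivative f (at (x + s *\<^sub>R axis i 1))"
  have D: "(f has_derivative ?D) (at (x + s *\<^sub>R axis i 1))"
    using assms by (rule differentiable_has_derivative)
  have "((\<lambda>s. x + s *\<^sub>R axis i 1) has_derivative (\<lambda>s. s *\<^sub>R axis i 1)) (at s within S)"
    by (auto intro!: derivative_eq_intros)
  from has_derivative_compose[OF this D]
  have "((\<lambda>s. f (x + s *\<^sub>R axis i 1)) has_derivative (\<lambda>s. ?D (s *\<^sub>R axis i 1))) (at s within S)" .
  moreover have "?D (s *\<^sub>R axis i 1) = s * ?D (axis i 1)" for s
    using linear_scale[OF has_derivative_linear[OF D]] by simp
  ultimately show ?thesis
    by (simp add: has_field_derivative_def partial_deriv_def mult_commute_abs)
qed

text \<open>Both mixed derivatives are limits of the same second difference quotient.\<close>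

lemma second_difference_mvt:
  fixes f :: "real^'n \<Rightarrow> real"
  assumes f: "\<And>x. f differentiable (at x)" and g: "\<And>x. partial_deriv i f differentiable (at x)"
    and "h > 0"
  obtains s t where "s \<in> {0..h}" "t \<in> {0..h}"
    "f (x + h *\<^sub>R axis i 1 + h *\<^sub>R axis j 1) - f (x + h *\<^sub>R axis i 1) - f (x + h *\<^sub>R axis j 1) + f x
      = h\<^sup>2 * partial_deriv j (partial_deriv i f) (x + s *\<^sub>R axis i 1 + t *\<^sub>R axis j 1)"
proof -
  define F where "F s = f ((x + h *\<^sub>R axis j 1) + s *\<^sub>R axis i 1) - f (x + s *\<^sub>R axis i 1)" for s
  have "(F has_real_derivative partial_deriv i f ((x + h *\<^sub>R axis j 1) + s *\<^sub>R axis i 1)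
      - partial_deriv i f (x + s *\<^sub>R axis i 1)) (at s)" for s
    unfolding F_def by (intro DERIV_diff has_real_derivative_along_axis f)
  from MVT2[OF \<open>h > 0\<close> this] obtain s where s: "0 < s" "s < h"
    "F h - F 0 = h * (partial_deriv i f ((x + h *\<^sub>R axis j 1) + s *\<^sub>R axis i 1)
      - partial_deriv i f (x + s *\<^sub>R axis i 1))" by auto
  have "((\<lambda>t. partial_deriv i f ((x + s *\<^sub>R axis i 1) + t *\<^sub>R axis j 1)) has_real_derivative
      partial_deriv j (partial_deriv i f) ((x + s *\<^sub>R axis i 1) + t *\<^sub>R axis j 1)) (at t)" for t
    by (intro has_real_derivative_along_axis g)
  from MVT2[OF \<open>h > 0\<close> this] obtain t where t: "0 < t" "t < h"
    "partial_deriv i f ((x + s *\<^sub>R axis i 1) + h *\<^sub>R axis j 1) - partial_deriv i f (x + s *\<^sub>R axis i 1)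
     = h * partial_deriv j (partial_deriv i f) ((x + s *\<^sub>R axis i 1) + t *\<^sub>R axis j 1)" by auto
  have "F h - F 0 = h\<^sup>2 * partial_deriv j (partial_deriv i f) (x + s *\<^sub>R axis i 1 + t *\<^sub>R axis j 1)"
    using s(3) t(3) by (simp add: power2_eq_square algebra_simps)
  moreover have "F h - F 0 = f (x + h *\<^sub>R axis i 1 + h *\<^sub>R axis j 1) - f (x + h *\<^sub>R axis i 1)
      - f (x + h *\<^sub>R axis j 1) + f x"
    by (simp add: F_def algebra_simps)
  ultimately show ?thesis using that[of s t] s t by auto
qed

lemma partial_deriv_commute:
  fixes f :: "real^'n \<Rightarrow> real"
  assumes "smooth f"
  shows "partial_deriv i (partial_deriv j f) = partial_deriv j (partial_deriv i f)"
proof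
  fix x :: "real^'n"
  let ?A = "partial_deriv i (partial_deriv j f)" and ?B = "partial_deriv j (partial_deriv i f)"
  have cA: "continuous_on UNIV ?A" and cB: "continuous_on UNIV ?B"
    using assms by (auto intro!: smooth_continuous smooth_partial_deriv)
  have d: "\<And>x. f differentiable (at x)" "\<And>k x. partial_deriv k f differentiable (at x)"
    using assms by (auto intro!: smooth_differentiable smooth_partial_deriv)
  show "?A x = ?B x"
  proof (rule ccontr)
    assume "?A x \<noteq> ?B x"
    \<comment> \<open>Half of the gap: values strictly within \<open>e\<close> of
      \<open>?A x\<close> and of \<open>?B x\<close> cannot coincide.\<close>
    define e where "e = \<bar>?A x - ?B x\<bar> / 2"
    have "e > 0" using \<open>?A x \<noteq> ?B x\<close> by (simp add: e_def)
    obtain d1 where d1: "d1 > 0" "\<And>y. dist y x < d1 \<Longrightarrow> \<bar>?A y - ?A x\<bar> < e"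
      using cA \<open>e > 0\<close> unfolding continuous_on_iff dist_real_def by (meson UNIV_I)
    obtain d2 where d2: "d2 > 0" "\<And>y. dist y x < d2 \<Longrightarrow> \<bar>?B y - ?B x\<bar> < e"
      using cB \<open>e > 0\<close> unfolding continuous_on_iff dist_real_def by (meson UNIV_I)
    \<comment> \<open>The intermediate points move by at most \<open>h\<close> along each of two
      axes, so by at most \<open>2 * h\<close> in total, which stays below both radii.\<close>
    define h where "h = min d1 d2 / 3"
    have h: "h > 0" using d1 d2 by (simp add: h_def)
    have close: "dist (x + s *\<^sub>R axis k 1 + t *\<^sub>R axis l 1) x < min d1 d2"
      if "s \<in> {0..h}" "t \<in> {0..h}" for s t and k l :: 'n
    proof -
      have "dist (x + s *\<^sub>R axis k 1 + t *\<^sub>R axis l 1) x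
          = norm (s *\<^sub>R axis k 1 + t *\<^sub>R axis l (1::real))"
        by (simp add: dist_norm)
      also have "\<dots> \<le> norm (s *\<^sub>R axis k (1::real)) + norm (t *\<^sub>R axis l (1::real))" by (rule norm_triangle_ineq)
      also have "\<dots> \<le> 2 * h" using that by simp
      also have "\<dots> < min d1 d2" using d1(1) d2(1) by (auto simp: h_def min_def)
      finally show ?thesis .
    qed
    obtain s t where st: "s \<in> {0..h}" "t \<in> {0..h}"
      "f (x + h *\<^sub>R axis i 1 + h *\<^sub>R axis j 1) - f (x + h *\<^sub>R axis i 1) - f (x + h *\<^sub>R axis j 1) + f x
      = h\<^sup>2 * ?B (x + s *\<^sub>R axis i 1 + t *\<^sub>R axis j 1)"
      using second_difference_mvt[OF d h] .
    obtain s' t' where st': "s' \<in> {0..h}" "t' \<in> {0..h}"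
      "f (x + h *\<^sub>R axis j 1 + h *\<^sub>R axis i 1) - f (x + h *\<^sub>R axis j 1) - f (x + h *\<^sub>R axis i 1) + f x
      = h\<^sup>2 * ?A (x + s' *\<^sub>R axis j 1 + t' *\<^sub>R axis i 1)"
      using second_difference_mvt[OF d h] .
    have "h\<^sup>2 * ?B (x + s *\<^sub>R axis i 1 + t *\<^sub>R axis j 1) = h\<^sup>2 * ?A (x + s' *\<^sub>R axis j 1 + t' *\<^sub>R axis i 1)"
      using st(3) st'(3) by (simp add: algebra_simps)
    then have "?B (x + s *\<^sub>R axis i 1 + t *\<^sub>R axis j 1) = ?A (x + s' *\<^sub>R axis j 1 + t' *\<^sub>R axis i 1)"
      using h by simp
    moreover have "\<bar>?B (x + s *\<^sub>R axis i 1 + t *\<^sub>R axis j 1) - ?B x\<bar> < e"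
      using d2(2) close[OF st(1,2)] by simp
    moreover have "\<bar>?A (x + s' *\<^sub>R axis j 1 + t' *\<^sub>R axis i 1) - ?A x\<bar> < e"
      using d1(2) close[OF st'(1,2)] by simp
    moreover have "2 * e = \<bar>?A x - ?B x\<bar>" by (simp add: e_def)
    ultimately show False by (smt (verit))
  qed
qed

section \<open>Iterated partial derivatives and multi-indices\<close>

lemma smooth_funpow: "smooth f \<Longrightarrow> smooth ((partial_deriv i ^^ k) f)"
  by (induction k) (auto intro: smooth_partial_deriv)

lemma partial_deriv_funpow_commute:
  "smooth f \<Longrightarrow> partial_deriv i ((partial_deriv j ^^ k) f) = (partial_deriv j ^^ k) (partial_deriv i f)"
  by (induction k) (auto simp: partial_deriv_commute[of _ i j] smooth_funpow)

lemma smooth_foldr: "smooth f \<Longrightarrow> smooth (foldr (\<lambda>i. partial_deriv i ^^ \<alpha> i) is f)"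
  by (induction "is") (auto intro: smooth_funpow)

lemma partial_deriv_foldr_commute:
  "smooth f \<Longrightarrow> partial_deriv i (foldr (\<lambda>j. partial_deriv j ^^ \<alpha> j) is f) =
    foldr (\<lambda>j. partial_deriv j ^^ \<alpha> j) is (partial_deriv i f)"
  by (induction "is") (auto simp: partial_deriv_funpow_commute smooth_foldr)

text \<open>The outer derivative commutes past the blocks of the other coordinates until it joins
  the block of its own; distinctness guarantees that exactly one block grows.\<close>

lemma partial_deriv_foldr:
  assumes "smooth f" "distinct is" "i \<in> set is"
  shows "partial_deriv i (foldr (\<lambda>j. partial_deriv j ^^ \<alpha> j) is f) =
    foldr (\<lambda>j. partial_deriv j ^^ (\<alpha>(i := Suc (\<alpha> i))) j) is f"
  using assms(2,3)
proof (induction "is")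
  case (Cons j "is")
  show ?case
  proof (cases "j = i")
    case True
    have "foldr (\<lambda>j. partial_deriv j ^^ (\<alpha>(i := Suc (\<alpha> i))) j) is f
        = foldr (\<lambda>j. partial_deriv j ^^ \<alpha> j) is f"
      using Cons.prems True by (intro foldr_cong) auto
    with True show ?thesis by simp
  next
    case False
    with Cons show ?thesis
      by (simp add: partial_deriv_funpow_commute smooth_foldr assms)
  qed
qed auto

lemma coord_enum: "distinct (coord_enum :: 'n::finite list)" "set (coord_enum :: 'n list) = UNIV"
proof -
  have "\<exists>is :: 'n list. distinct is \<and> set is = UNIV"
    using finite_distinct_list[of "UNIV :: 'n set"] by auto
  from someI_ex[OF this] show "distinct (coord_enum :: 'n list)" "set (coord_enum :: 'n list) = UNIV"
    unfolding coord_enum_def by auto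
qed

lemma partial_deriv_classical_deriv:
  "smooth f \<Longrightarrow> partial_deriv i (classical_deriv \<alpha> f) = classical_deriv (\<alpha>(i := Suc (\<alpha> i))) f"
  unfolding classical_deriv_def by (rule partial_deriv_foldr) (auto simp: coord_enum)

lemma funpow_partial_deriv_classical_deriv:
  "smooth f \<Longrightarrow> (partial_deriv i ^^ k) (classical_deriv \<alpha> f) = classical_deriv (\<alpha>(i := \<alpha> i + k)) f"
  by (induction k) (auto simp: partial_deriv_classical_deriv)

lemma mi_order_upd: "mi_order (\<alpha>(i := \<alpha> i + k)) = mi_order \<alpha> + k"
proof -
  have "mi_order (\<alpha>(i := \<alpha> i + k)) = (\<Sum>j\<in>UNIV. \<alpha> j + (if j = i then k else 0))"
    unfolding mi_order_def by (intro sum.cong) auto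
  also have "\<dots> = mi_order \<alpha> + k"
    by (simp add: sum.distrib mi_order_def)
  finally show ?thesis .
qed

lemma finite_mi_order_le: "finite {\<alpha> :: 'n::finite \<Rightarrow> nat. mi_order \<alpha> \<le> m}"
proof (rule finite_subset)
  show "{\<alpha> :: 'n \<Rightarrow> nat. mi_order \<alpha> \<le> m} \<subseteq> PiE UNIV (\<lambda>_. {..m})"
  proof (clarsimp simp: PiE_def Pi_def)
    fix \<alpha> :: "'n \<Rightarrow> nat" and i assume "mi_order \<alpha> \<le> m"
    moreover have "\<alpha> i \<le> mi_order \<alpha>" unfolding mi_order_def by (rule member_le_sum) auto
    ultimately show "\<alpha> i \<le> m" by simp
  qed
qed (auto intro: finite_PiE)

subsection \<open>Smooth bump functions\<close>

text \<open>The function \<open>exp (- (1 / t))\<close> extended by zero, with a polynomial weight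
  in \<open>1 / t\<close> that makes the family closed under differentiation.\<close>

definition flat :: "real poly \<Rightarrow> real \<Rightarrow> real" where
  "flat p t = (if t > 0 then poly p (1 / t) * exp (- (1 / t)) else 0)"

lemma tendsto_poly_div_exp: "((\<lambda>y::real. poly p y / exp y) \<longlongrightarrow> 0) at_top"
proof -
  have "((\<lambda>y::real. \<Sum>i\<le>degree p. coeff p i * (y ^ i / exp y)) \<longlongrightarrow> (\<Sum>i\<le>degree p. coeff p i * 0)) at_top"
    by (intro tendsto_intros tendsto_power_div_exp_0)
  then show ?thesis by (simp add: poly_altdef sum_divide_distrib)
qed

text \<open>For positive \<open>t\<close> the chain rule turns \<open>p\<close> into
  \<open>p - pderiv p\<close> and contributes \<open>1 / t\<close> squared, which is the factor
  \<open>[:0,0,1:]\<close>. At 0 only the right-hand difference quotient needs an argument: the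
  exponential beats every polynomial.\<close>

lemma flat_has_derivative:
  "(flat p has_real_derivative flat ([:0,0,1:] * (p - pderiv p)) t) (at t)"
proof (cases t "0::real" rule: linorder_cases)
  case less
  have "((\<lambda>_. 0) has_real_derivative 0) (at t)" by simp
  then have "(flat p has_real_derivative 0) (at t)"
    by (rule has_field_derivative_transform_within_open[where S = "{..<0}"]) (use less in \<open>auto simp: flat_def\<close>)
  with less show ?thesis by (simp add: flat_def)
next
  case equal
  have "((\<lambda>h. flat p h / h) \<longlongrightarrow> 0) (at_left 0)"
  proof (rule tendsto_eventually)
    show "\<forall>\<^sub>F h in at_left 0. flat p h / h = 0"
      by (auto simp: flat_def eventually_at_filter)
  qed
  moreover have "((\<lambda>h. flat p h / h) \<longlongrightarrow> 0) (at_right 0)"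
  proof (rule Lim_transform_eventually)
    \<comment> \<open>The division by \<open>h\<close> in the difference quotient is the extra
      factor \<open>[:0,1:]\<close> in the variable \<open>inverse h\<close>.\<close>
    show "((\<lambda>h. poly ([:0,1:] * p) (inverse h) / exp (inverse h)) \<longlongrightarrow> 0) (at_right (0::real))"
      using filterlim_compose[OF tendsto_poly_div_exp filterlim_inverse_at_top_right] .
    show "\<forall>\<^sub>F h in at_right 0. poly ([:0,1:] * p) (inverse h) / exp (inverse h) = flat p h / h"
      by (auto simp: flat_def eventually_at_filter exp_minus field_simps)
  qed
  ultimately have "((\<lambda>h. flat p h / h) \<longlongrightarrow> 0) (at 0)"
    by (rule filterlim_split_at)
  then show ?thesis using equal by (simp add: has_field_derivative_iff flat_def)
next
  case greater
  have "((\<lambda>t. poly p (1 / t) * exp (- (1 / t))) has_real_derivative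
     flat ([:0,0,1:] * (p - pderiv p)) t) (at t)"
    using greater
    by (auto intro!: derivative_eq_intros DERIV_chain'[OF _ poly_DERIV]
         simp: flat_def field_simps power2_eq_square)
  then show ?thesis
    by (rule has_field_derivative_transform_within_open[where S = "{0<..}"]) (use greater in \<open>auto simp: flat_def\<close>)
qed

lemma smooth_flat_component: "smooth (\<lambda>x::real^'n. flat p (a * x $ i + b))"
proof -
  \<comment> \<open>Generalised over \<open>c\<close> and \<open>p\<close>: a partial derivative
    changes the polynomial and multiplies by a constant.\<close>
  have "C_k k (\<lambda>x::real^'n. c * flat p (a * x $ i + b))" for k c p
  proof (induction k arbitrary: c p)
    case 0
    have "continuous_on UNIV (flat p)"
      by (meson DERIV_continuous_on flat_has_derivative)
    then have "continuous_on UNIV (\<lambda>x::real^'n. flat p (a * x $ i + b))"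
      by (rule continuous_on_compose2) (auto intro!: continuous_intros)
    then show ?case by (auto intro!: continuous_intros)
  next
    case (Suc k)
    let ?q = "[:0,0,1:] * (p - pderiv p)"
    have D: "((\<lambda>x::real^'n. c * flat p (a * x $ i + b)) has_derivative
        (\<lambda>h. c * (flat ?q (a * x $ i + b) * (a * h $ i)))) (at x)" for x
    proof -
      have "((\<lambda>x::real^'n. a * x $ i + b) has_derivative (\<lambda>h. a * h $ i)) (at x)"
        by (auto intro!: derivative_eq_intros bounded_linear_imp_has_derivative bounded_linear_vec_nth)
      from has_derivative_compose[OF this, of "flat p"]
      show ?thesis
        using flat_has_derivative[of p "a * x $ i + b"]
        by (auto simp: has_field_derivative_def intro!: has_derivative_mult_right)
    qed
    have "partial_deriv j (\<lambda>x::real^'n. c * flat p (a * x $ i + b)) =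
       (\<lambda>x. (c * (a * axis j 1 $ i)) * flat ?q (a * x $ i + b))" for j
      by (rule ext, subst partial_deriv_eqI[OF D]) auto
    with Suc.IH D show ?case by (auto simp: differentiable_def simp del: mult_pCons_left)
  qed
  from this[where c = 1] show ?thesis by (simp add: smooth_def)
qed

section \<open>Test functions and integration by parts\<close>

lemma test_functions_iff:
  "f \<in> test_functions \<Omega> \<longleftrightarrow> smooth f \<and> compact (closure {x. f x \<noteq> 0}) \<and> closure {x. f x \<noteq> 0} \<subseteq> \<Omega>"
  by (simp add: test_functions_def smooth_def)

lemma test_functions_smooth: "f \<in> test_functions \<Omega> \<Longrightarrow> smooth f"
  by (simp add: test_functions_iff)

lemma test_functions_compactI:
  assumes "smooth g" "compact K" "K \<subseteq> \<Omega>" "\<And>x. x \<notin> K \<Longrightarrow> g x = 0"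
  shows "g \<in> test_functions \<Omega>"
proof -
  have sub: "closure {x. g x \<noteq> 0} \<subseteq> K"
    using assms(2,4) by (intro closure_minimal compact_imp_closed) auto
  then have "closure {x. g x \<noteq> 0} \<inter> K = closure {x. g x \<noteq> 0}" by (rule Int_absorb2)
  then have "compact (closure {x. g x \<noteq> 0})"
    using closed_Int_compact[OF closed_closure \<open>compact K\<close>, of "{x. g x \<noteq> 0}"] by simp
  with sub assms(1,3) show ?thesis by (simp add: test_functions_iff subset_trans)
qed

lemma test_functions_supportI:
  assumes "f \<in> test_functions \<Omega>" "smooth g" "closure {x. g x \<noteq> 0} \<subseteq> closure {x. f x \<noteq> 0}"
  shows "g \<in> test_functions \<Omega>"
proof (rule test_functions_compactI)
  show "compact (closure {x. f x \<noteq> 0})" "closure {x. f x \<noteq> 0} \<subseteq> \<Omega>"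
    using assms(1) by (simp_all add: test_functions_iff)
  show "g x = 0" if "x \<notin> closure {x. f x \<noteq> 0}" for x
    using that assms(3) closure_subset[of "{x. g x \<noteq> 0}"] by blast
qed (rule assms)

lemma test_functions_compactE:
  assumes "f \<in> test_functions \<Omega>"
  obtains K where "compact K" "K \<subseteq> \<Omega>" "\<And>x. x \<notin> K \<Longrightarrow> f x = 0"
proof
  show "f x = 0" if "x \<notin> closure {x. f x \<noteq> 0}" for x
    using that closure_subset[of "{x. f x \<noteq> 0}"] by auto
qed (use assms in \<open>simp_all add: test_functions_iff\<close>)

lemma partial_deriv_support: "closure {x. partial_deriv i f x \<noteq> 0} \<subseteq> closure {x. f x \<noteq> 0}"
proof (rule closure_minimal)
  show "{x. partial_deriv i f x \<noteq> 0} \<subseteq> closure {x. f x \<noteq> 0}"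
  proof (rule ccontr)
    assume "\<not> ?thesis"
    then obtain x where x: "partial_deriv i f x \<noteq> 0" "x \<notin> closure {x. f x \<noteq> 0}" by auto
    have z: "0 = f y" if "y \<in> - closure {x. f x \<noteq> 0}" for y
      using that closure_subset[of "{x. f x \<noteq> 0}"] by auto
    have "((\<lambda>_. 0) has_derivative (\<lambda>_. 0)) (at x)" by simp
    then have "(f has_derivative (\<lambda>_. 0)) (at x)"
      by (rule has_derivative_transform_within_open[where s = "- closure {x. f x \<noteq> 0}", OF _ _ _ z]) (use x(2) in \<open>auto simp: open_Compl\<close>)
    from partial_deriv_eqI[OF this] x show False by simp
  qed
qed simp

lemma test_partial_deriv: "f \<in> test_functions \<Omega> \<Longrightarrow> partial_deriv i f \<in> test_functions \<Omega>"
  by (rule test_functions_supportI[OF _ smooth_partial_deriv partial_deriv_support])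
    (simp_all add: test_functions_iff)

lemma test_funpow: "f \<in> test_functions \<Omega> \<Longrightarrow> (partial_deriv i ^^ k) f \<in> test_functions \<Omega>"
  by (induction k) (auto intro: test_partial_deriv)

lemma test_foldr: "f \<in> test_functions \<Omega> \<Longrightarrow> foldr (\<lambda>i. partial_deriv i ^^ \<alpha> i) is f \<in> test_functions \<Omega>"
  by (induction "is") (auto intro: test_funpow)

lemma test_classical_deriv: "f \<in> test_functions \<Omega> \<Longrightarrow> classical_deriv \<alpha> f \<in> test_functions \<Omega>"
  unfolding classical_deriv_def by (rule test_foldr)

lemma test_mult:
  assumes "f \<in> test_functions \<Omega>" "g \<in> test_functions \<Omega>"
  shows "(\<lambda>x. f x * g x) \<in> test_functions \<Omega>"
  by (rule test_functions_supportI[OF assms(1)])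
    (use assms in \<open>simp_all add: smooth_mult closure_mono Collect_mono test_functions_smooth\<close>)

lemma test_cmult:
  assumes "f \<in> test_functions \<Omega>"
  shows "(\<lambda>x. c * f x) \<in> test_functions \<Omega>"
  by (rule test_functions_supportI[OF assms(1)])
    (use assms in \<open>simp_all add: smooth_cmult closure_mono Collect_mono test_functions_smooth\<close>)

section \<open>Integrals of test functions and integration by parts\<close>

lemma compact_support_integrable:
  fixes g :: "real^'n \<Rightarrow> real"
  assumes "continuous_on UNIV g" "compact K" "\<And>x. x \<notin> K \<Longrightarrow> g x = 0"
  shows "integrable lborel g"
proof -
  have "integrable lborel (\<lambda>x. indicator K x *\<^sub>R g x)"
    using assms by (intro borel_integrable_compact) (auto intro: continuous_on_subset)
  also have "(\<lambda>x. indicator K x *\<^sub>R g x) = g"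
    using assms(3) by (auto simp: indicator_def fun_eq_iff)
  finally show ?thesis .
qed

lemma test_integrable: "f \<in> test_functions \<Omega> \<Longrightarrow> integrable lborel f"
  by (metis compact_support_integrable smooth_continuous test_functions_compactE test_functions_smooth)

text \<open>The passage to \<open>lborel\<close> on the whole space gives access to Fubini and
  translation invariance.\<close>

lemma integral_lebesgue_on_test:
  assumes "open \<Omega>" "f \<in> test_functions \<Omega>"
  shows "(LINT x|lebesgue_on \<Omega>. f x) = (LINT x|lborel. f x)"
proof -
  obtain K where K: "K \<subseteq> \<Omega>" "\<And>x. x \<notin> K \<Longrightarrow> f x = 0" using assms(2) by (rule test_functions_compactE) blast
  have "(LINT x|lebesgue_on \<Omega>. f x) = (LINT x|lebesgue. indicator \<Omega> x *\<^sub>R f x)"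
    using assms(1) by (intro integral_restrict_space) auto
  also have "(\<lambda>x. indicator \<Omega> x *\<^sub>R f x) = f"
    using K by (auto simp: indicator_def fun_eq_iff)
  also have "(LINT x|lebesgue. f x) = (LINT x|lborel. f x)"
    using test_integrable[OF assms(2)] by (intro integral_completion) auto
  finally show ?thesis .
qed

text \<open>Averaging the derivative over a unit shift along the axis reduces the claim to translation
  invariance, so no slicing of the Lebesgue measure on \<open>real^'n\<close> is needed.\<close>

lemma integral_partial_deriv_test:
  fixes f :: "real^'n \<Rightarrow> real"
  assumes f: "f \<in> test_functions \<Omega>"
  shows "(LINT x|lborel. partial_deriv i f x) = 0"
proof -
  let ?e = "axis i 1 :: real^'n" and ?d = "partial_deriv i f"
  obtain K where K: "compact K" "\<And>x. x \<notin> K \<Longrightarrow> ?d x = 0"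
    using test_partial_deriv[OF f, of i] by (rule test_functions_compactE) blast
  obtain R where R: "\<And>x. x \<in> K \<Longrightarrow> norm x \<le> R"
    using compact_imp_bounded[OF K(1)] by (auto simp: bounded_iff)
  have cd: "continuous_on UNIV ?d"
    using f by (auto intro!: smooth_continuous smooth_partial_deriv dest: test_functions_smooth)
  have meas: "?d \<in> borel_measurable borel"
    using cd by (rule borel_measurable_continuous_onI)
  have int: "integrable lborel ?d" by (rule test_integrable[OF test_partial_deriv[OF f]])
  define F where "F x s = indicator {0..1} s *\<^sub>R ?d (x + s *\<^sub>R ?e)" for x s
  \<comment> \<open>Joint integrability for Fubini: a shift by at most one unit vector moves the
    support, contained in the ball of radius \<open>R\<close>, to points of norm at most
    \<open>R + 1\<close>.\<close>
  have "integrable lborel (\<lambda>z. indicator (cball 0 (R + 1) \<times> {0..1}) z *\<^sub>R ?d (fst z + snd z *\<^sub>R ?e))"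
    by (intro borel_integrable_compact compact_Times compact_cball compact_Icc
        continuous_on_compose2[OF cd] continuous_intros) auto
  also have "(\<lambda>z. indicator (cball 0 (R + 1) \<times> {0..1}) z *\<^sub>R ?d (fst z + snd z *\<^sub>R ?e)) = case_prod F"
  proof (rule ext, clarify)
    fix x s
    show "indicator (cball 0 (R + 1) \<times> {0..1}) (x, s) *\<^sub>R ?d (fst (x, s) + snd (x, s) *\<^sub>R ?e) = F x s"
    proof (cases "s \<in> {0..1} \<and> x + s *\<^sub>R ?e \<in> K")
      case True
      then have "norm (x + s *\<^sub>R ?e) \<le> R" using R by blast
      moreover have "norm x \<le> norm (x + s *\<^sub>R ?e) + norm (s *\<^sub>R ?e)"
        by (metis add_diff_cancel norm_triangle_ineq4)
      ultimately have "norm x \<le> R + 1" using True by simp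
      then show ?thesis by (auto simp: F_def indicator_def)
    qed (auto simp: F_def indicator_def K)
  qed
  finally have "integrable (lborel \<Otimes>\<^sub>M lborel) (case_prod F)"
    by (simp add: lborel_prod)
  from lborel_pair.Fubini_integral[OF this]
  have "(LINT s|lborel. LINT x|lborel. F x s) = (LINT x|lborel. LINT s|lborel. F x s)" .
  also have "(\<lambda>x. LINT s|lborel. F x s) = (\<lambda>x. f (x + ?e) - f x)"
  proof
    fix x
    have "(LINT s|lborel. indicator {0..1} s *\<^sub>R ?d (x + s *\<^sub>R ?e)) = f (x + 1 *\<^sub>R ?e) - f (x + 0 *\<^sub>R ?e)"
      by (intro integral_FTC_atLeastAtMost continuous_on_compose2[OF cd] continuous_intros
          has_real_derivative_along_axis[unfolded has_real_derivative_iff_has_vector_derivative]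
          smooth_differentiable test_functions_smooth[OF f]) auto
    then show "(LINT s|lborel. F x s) = f (x + ?e) - f x" by (simp add: F_def)
  qed
  also have "(LINT x|lborel. f (x + ?e) - f x) = 0"
  proof -
    have i1: "integrable lborel f" by (rule test_integrable[OF f])
    have i2: "integrable (distr lborel borel ((+) ?e)) f" using i1 by (simp add: lborel_distr_plus)
    have "integrable lborel (\<lambda>x. f (?e + x))"
      using i2 by (subst (asm) integrable_distr_eq) (use i1 in auto)
    moreover have "(LINT x|lborel. f (?e + x)) = (LINT x|distr lborel borel ((+) ?e). f x)"
      using i1 by (subst integral_distr) auto
    ultimately show ?thesis using i1 by (simp add: lborel_distr_plus add.commute)
  qed
  also have "(\<lambda>s. LINT x|lborel. F x s) = (\<lambda>s. indicator {0..1} s *\<^sub>R (LINT x|lborel. ?d x))"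
  proof
    fix s
    have "(LINT x|lborel. ?d (s *\<^sub>R ?e + x)) = (LINT x|distr lborel borel ((+) (s *\<^sub>R ?e)). ?d x)"
      using meas by (subst integral_distr) auto
    then show "(LINT x|lborel. F x s) = indicator {0..1} s *\<^sub>R (LINT x|lborel. ?d x)"
      by (simp add: F_def lborel_distr_plus add.commute)
  qed
  finally show ?thesis by simp
qed

lemma integration_by_parts_test:
  assumes "open \<Omega>" "f \<in> test_functions \<Omega>" "g \<in> test_functions \<Omega>"
  shows "(LINT x|lebesgue_on \<Omega>. f x * partial_deriv i g x) = - (LINT x|lebesgue_on \<Omega>. partial_deriv i f x * g x)"
proof -
  have 1: "(\<lambda>x. f x * partial_deriv i g x) \<in> test_functions \<Omega>"
    and 2: "(\<lambda>x. partial_deriv i f x * g x) \<in> test_functions \<Omega>"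
    using assms by (auto intro!: test_mult test_partial_deriv)
  have "0 = (LINT x|lborel. partial_deriv i (\<lambda>x. f x * g x) x)"
    using integral_partial_deriv_test[OF test_mult[OF assms(2,3)]] by simp
  also have "\<dots> = (LINT x|lborel. f x * partial_deriv i g x + partial_deriv i f x * g x)"
    using assms by (intro Bochner_Integration.integral_cong partial_deriv_mult smooth_differentiable)
      (auto dest: test_functions_smooth)
  also have "\<dots> = (LINT x|lborel. f x * partial_deriv i g x) + (LINT x|lborel. partial_deriv i f x * g x)"
    by (intro Bochner_Integration.integral_add test_integrable[OF 1] test_integrable[OF 2])
  finally show ?thesis
    by (simp add: integral_lebesgue_on_test[OF assms(1) 1] integral_lebesgue_on_test[OF assms(1) 2])
qed

lemma integration_by_parts_funpow:
  assumes "open \<Omega>" "f \<in> test_functions \<Omega>" "g \<in> test_functions \<Omega>"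
  shows "(LINT x|lebesgue_on \<Omega>. f x * (partial_deriv i ^^ k) g x) =
    (-1) ^ k * (LINT x|lebesgue_on \<Omega>. (partial_deriv i ^^ k) f x * g x)"
  using assms(3)
proof (induction k arbitrary: g)
  case (Suc k)
  have "(LINT x|lebesgue_on \<Omega>. f x * (partial_deriv i ^^ Suc k) g x) =
    (LINT x|lebesgue_on \<Omega>. f x * (partial_deriv i ^^ k) (partial_deriv i g) x)"
    by (simp add: funpow_swap1)
  also have "\<dots> = (-1) ^ k * (LINT x|lebesgue_on \<Omega>. (partial_deriv i ^^ k) f x * partial_deriv i g x)"
    using Suc by (intro Suc.IH test_partial_deriv)
  also have "(LINT x|lebesgue_on \<Omega>. (partial_deriv i ^^ k) f x * partial_deriv i g x)
      = - (LINT x|lebesgue_on \<Omega>. (partial_deriv i ^^ Suc k) f x * g x)"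
    using integration_by_parts_test[OF assms(1) test_funpow[OF assms(2)] Suc.prems] by simp
  finally show ?case by simp
qed simp

lemma foldr_funpow_commute:
  "smooth f \<Longrightarrow> foldr (\<lambda>j. partial_deriv j ^^ \<alpha> j) is ((partial_deriv i ^^ k) f) =
    (partial_deriv i ^^ k) (foldr (\<lambda>j. partial_deriv j ^^ \<alpha> j) is f)"
  by (induction k) (auto simp: partial_deriv_foldr_commute[symmetric] smooth_funpow)

lemma integration_by_parts_foldr:
  assumes "open \<Omega>" "f \<in> test_functions \<Omega>" "g \<in> test_functions \<Omega>"
  shows "(LINT x|lebesgue_on \<Omega>. f x * foldr (\<lambda>j. partial_deriv j ^^ \<alpha> j) is g x) =
    (-1) ^ sum_list (map \<alpha> is) *
      (LINT x|lebesgue_on \<Omega>. foldr (\<lambda>j. partial_deriv j ^^ \<alpha> j) is f x * g x)"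
  using assms(2)
proof (induction "is" arbitrary: f)
  case (Cons i "is")
  \<comment> \<open>The outermost block of derivatives of \<open>g\<close> is moved onto
    \<open>f\<close>, where it becomes the innermost one. Hence the induction is over arbitrary
    \<open>f\<close>, and the blocks have to be commuted back at the end.\<close>
  have "(LINT x|lebesgue_on \<Omega>. f x * foldr (\<lambda>j. partial_deriv j ^^ \<alpha> j) (i # is) g x) =
     (-1) ^ \<alpha> i * (LINT x|lebesgue_on \<Omega>. (partial_deriv i ^^ \<alpha> i) f x * foldr (\<lambda>j. partial_deriv j ^^ \<alpha> j) is g x)"
    using integration_by_parts_funpow[OF assms(1) Cons.prems test_foldr[OF assms(3)]] by simp
  then show ?case
    using Cons.IH[OF test_funpow[OF Cons.prems]] test_functions_smooth[OF Cons.prems]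
    by (simp add: foldr_funpow_commute power_add)
qed simp

section \<open>Distributional derivatives of test functions and of differences\<close>

lemma continuous_locally_integrable:
  fixes f :: "real^'n \<Rightarrow> real"
  assumes "continuous_on UNIV f"
  shows "locally_integrable \<Omega> f"
  unfolding locally_integrable_def
proof (intro allI impI)
  fix K :: "(real^'n) set" assume K: "compact K \<and> K \<subseteq> \<Omega>"
  have "integrable lborel (\<lambda>x. indicator K x *\<^sub>R f x)"
    using K assms by (intro borel_integrable_compact) (auto intro: continuous_on_subset)
  then show "integrable (lebesgue_on K) f"
    using K by (subst integrable_restrict_space) (auto simp: integrable_completion lmeasurable_compact fmeasurableD)
qed

lemma test_is_weak_deriv:
  assumes "open \<Omega>" "f \<in> test_functions \<Omega>"
  shows "is_weak_deriv \<Omega> \<alpha> f (classical_deriv \<alpha> f)"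
proof -
  have "sum_list (map \<alpha> coord_enum) = mi_order \<alpha>"
    unfolding mi_order_def using coord_enum by (metis sum_list_distinct_conv_sum_set)
  then show ?thesis
    unfolding is_weak_deriv_def
    using assms integration_by_parts_foldr[OF assms, of _ \<alpha> coord_enum]
    by (auto simp: classical_deriv_def[symmetric] intro!: continuous_locally_integrable smooth_continuous
        test_functions_smooth test_classical_deriv)
qed

text \<open>Additivity of the Bochner integral requires integrability of each summand. A test
  function is bounded and lives on a compact subset of \<open>\<Omega>\<close>, where
  \<open>u\<close> is integrable.\<close>

lemma integrable_test_mult:
  assumes "open \<Omega>" "locally_integrable \<Omega> u" "f \<in> test_functions \<Omega>"
  shows "integrable (lebesgue_on \<Omega>) (\<lambda>x. u x * f x)"
proof -
  obtain K where K: "compact K" "K \<subseteq> \<Omega>" "\<And>x. x \<notin> K \<Longrightarrow> f x = 0"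
    using assms(3) by (rule test_functions_compactE) blast
  have Ks: "K \<in> sets lebesgue" using K(1) by (simp add: compact_imp_closed)
  have "bounded (f ` K)"
    using K(1) smooth_continuous[OF test_functions_smooth[OF assms(3)]]
    by (intro compact_imp_bounded compact_continuous_image) (auto intro: continuous_on_subset)
  then obtain B where B: "\<And>x. x \<in> K \<Longrightarrow> \<bar>f x\<bar> \<le> B" by (auto simp: bounded_iff)
  have fm: "f \<in> borel_measurable lebesgue"
    using test_integrable[OF assms(3)] by (auto intro: measurable_completion)
  have "integrable (lebesgue_on K) u" using assms(2) K by (auto simp: locally_integrable_def)
  then have iu: "integrable lebesgue (\<lambda>x. indicator K x *\<^sub>R u x)"
    using Ks by (simp add: integrable_restrict_space)
  have "integrable lebesgue (\<lambda>x. B * (indicator K x *\<^sub>R u x))"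
    using iu by (intro integrable_mult_right)
  then have "integrable lebesgue (\<lambda>x. (indicator K x *\<^sub>R u x) * f x)"
  proof (rule Bochner_Integration.integrable_bound)
    show "(\<lambda>x. (indicator K x *\<^sub>R u x) * f x) \<in> borel_measurable lebesgue"
      using iu fm by (intro borel_measurable_times) auto
    show "AE x in lebesgue. norm (indicator K x *\<^sub>R u x * f x) \<le> norm (B * (indicator K x *\<^sub>R u x))"
    proof (intro AE_I2)
      fix x
      show "norm (indicator K x *\<^sub>R u x * f x) \<le> norm (B * (indicator K x *\<^sub>R u x))"
        using B[of x] by (auto simp: indicator_def abs_mult mult.commute[of _ "\<bar>u x\<bar>"] intro!: mult_left_mono)
    qed
  qed
  also have "(\<lambda>x. (indicator K x *\<^sub>R u x) * f x) = (\<lambda>x. indicator \<Omega> x *\<^sub>R (u x * f x))"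
    using K by (auto simp: fun_eq_iff indicator_def)
  finally show ?thesis using assms(1) by (subst integrable_restrict_space) auto
qed

lemma is_weak_deriv_diff:
  assumes "open \<Omega>" "is_weak_deriv \<Omega> \<alpha> u v" "is_weak_deriv \<Omega> \<alpha> u' v'"
  shows "is_weak_deriv \<Omega> \<alpha> (\<lambda>x. u x - u' x) (\<lambda>x. v x - v' x)"
proof -
  have l: "locally_integrable \<Omega> u" "locally_integrable \<Omega> v" "locally_integrable \<Omega> u'" "locally_integrable \<Omega> v'"
    using assms by (auto simp: is_weak_deriv_def)
  then have l': "locally_integrable \<Omega> (\<lambda>x. u x - u' x)" "locally_integrable \<Omega> (\<lambda>x. v x - v' x)"
    by (auto simp: locally_integrable_def)
  show ?thesis
    unfolding is_weak_deriv_def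
  proof (intro conjI l' ballI)
    fix \<phi> assume \<phi>: "\<phi> \<in> test_functions \<Omega>"
    have "(LINT x|lebesgue_on \<Omega>. (u x - u' x) * classical_deriv \<alpha> \<phi> x) =
      (LINT x|lebesgue_on \<Omega>. u x * classical_deriv \<alpha> \<phi> x) - (LINT x|lebesgue_on \<Omega>. u' x * classical_deriv \<alpha> \<phi> x)"
      by (simp add: left_diff_distrib Bochner_Integration.integral_diff
          integrable_test_mult[OF assms(1) l(1)] integrable_test_mult[OF assms(1) l(3)] test_classical_deriv \<phi>)
    moreover have "(LINT x|lebesgue_on \<Omega>. (v x - v' x) * \<phi> x) =
      (LINT x|lebesgue_on \<Omega>. v x * \<phi> x) - (LINT x|lebesgue_on \<Omega>. v' x * \<phi> x)"
      by (simp add: left_diff_distrib Bochner_Integration.integral_diff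
          integrable_test_mult[OF assms(1) l(2)] integrable_test_mult[OF assms(1) l(4)] \<phi>)
    ultimately show "(LINT x|lebesgue_on \<Omega>. (u x - u' x) * classical_deriv \<alpha> \<phi> x) =
      (-1) ^ mi_order \<alpha> * (LINT x|lebesgue_on \<Omega>. (v x - v' x) * \<phi> x)"
      using assms(2,3) \<phi> unfolding is_weak_deriv_def by (simp add: right_diff_distrib)
  qed
qed

section \<open>Uniqueness of weak derivatives\<close>

text \<open>A smooth function supported in the closed box that tends to the indicator of the open
  box as \<open>k\<close> grows. The arguments of \<open>flat 1\<close> are \<open>k\<close> times
  the signed distances to the faces, expanded into the affine form that
  \<open>smooth_flat_component\<close> expects.\<close>

definition box_bump :: "real^'n \<Rightarrow> real^'n \<Rightarrow> real \<Rightarrow> real^'n \<Rightarrow> real" where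
  "box_bump a b k x = (\<Prod>j\<in>UNIV. flat 1 (k * x $ j + - (k * a $ j)) * flat 1 ((- k) * x $ j + k * b $ j))"

lemma smooth_box_bump: "smooth (box_bump a b k)"
  unfolding box_bump_def by (intro smooth_prod smooth_mult smooth_flat_component)

lemma flat_1_bounds: "0 \<le> flat 1 t" "flat 1 t \<le> 1"
  by (auto simp: flat_def)

lemma box_bump_bounds: "0 \<le> box_bump a b k x" "box_bump a b k x \<le> 1"
  unfolding box_bump_def using flat_1_bounds
  by (auto intro!: prod_nonneg prod_le_1 mult_le_one)

lemma box_bump_outside:
  assumes "k > 0" "x \<notin> box a b"
  shows "box_bump a b k x = 0"
proof -
  obtain j where "x $ j \<le> a $ j \<or> b $ j \<le> x $ j"
    using assms(2) by (auto simp: mem_box_cart not_less)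
  then have "k * x $ j + - (k * a $ j) \<le> 0 \<or> (- k) * x $ j + k * b $ j \<le> 0"
    using \<open>k > 0\<close> by (simp add: mult_le_cancel_left)
  then have "flat 1 (k * x $ j + - (k * a $ j)) * flat 1 ((- k) * x $ j + k * b $ j) = 0"
    by (auto simp: flat_def)
  then show ?thesis unfolding box_bump_def by (meson UNIV_I finite prod_zero)
qed

lemma flat_1_scale_tendsto:
  assumes "c > 0"
  shows "(\<lambda>n. flat 1 (real (Suc n) * c)) \<longlonglongrightarrow> 1"
proof -
  have "(\<lambda>n. exp (- ((1 / c) * inverse (real (Suc n))))) \<longlonglongrightarrow> exp (- ((1 / c) * 0))"
    by (intro tendsto_intros LIMSEQ_inverse_real_of_nat)
  moreover have "exp (- ((1 / c) * inverse (real (Suc n)))) = flat 1 (real (Suc n) * c)" for n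
  proof -
    have "real (Suc n) * c > 0" using assms by simp
    then show ?thesis by (simp add: flat_def divide_simps)
  qed
  ultimately show ?thesis by simp
qed

lemma box_bump_tendsto:
  "(\<lambda>n. box_bump a b (real (Suc n)) x) \<longlonglongrightarrow> indicator (box a b) x"
proof (cases "x \<in> box a b")
  case True
  have "(\<lambda>n. box_bump a b (real (Suc n)) x) \<longlonglongrightarrow> (\<Prod>j\<in>(UNIV :: 'a set). 1 * 1)"
    unfolding box_bump_def
  proof (intro tendsto_prod tendsto_mult)
    fix j
    have "x $ j - a $ j > 0" "b $ j - x $ j > 0" using True by (auto simp: mem_box_cart)
    moreover have "real (Suc n) * x $ j + - (real (Suc n) * a $ j) = real (Suc n) * (x $ j - a $ j)"
      "- real (Suc n) * x $ j + real (Suc n) * b $ j = real (Suc n) * (b $ j - x $ j)" for n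
      by (simp_all add: algebra_simps)
    ultimately show "(\<lambda>n. flat 1 (real (Suc n) * x $ j + - (real (Suc n) * a $ j))) \<longlonglongrightarrow> 1"
      "(\<lambda>n. flat 1 (- real (Suc n) * x $ j + real (Suc n) * b $ j)) \<longlonglongrightarrow> 1"
      using flat_1_scale_tendsto by presburger+
  qed
  with True show ?thesis by simp
next
  case False
  then show ?thesis by (simp add: box_bump_outside)
qed

text \<open>The bumps are test functions because the closed box lies in \<open>\<Omega>\<close>;
  being bounded by 1 and converging to the indicator of the open box, they allow dominated
  convergence with majorant \<open>f\<close> cut off to the closed box.\<close>

lemma integral_box_zero:
  fixes f :: "real^'n \<Rightarrow> real"
  assumes "open \<Omega>" "locally_integrable \<Omega> f"
    and zero: "\<And>\<psi>. \<psi> \<in> test_functions \<Omega> \<Longrightarrow> (LINT x|lebesgue_on \<Omega>. f x * \<psi> x) = 0"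
    and sub: "cbox a b \<subseteq> \<Omega>"
  shows "(LINT x|lebesgue. indicator (box a b) x * f x) = 0"
proof -
  let ?\<psi> = "\<lambda>n. box_bump a b (real (Suc n))"
  have test: "?\<psi> n \<in> test_functions \<Omega>" for n
    by (rule test_functions_compactI[of _ "cbox a b"])
      (use sub box_subset_cbox in \<open>auto intro!: smooth_box_bump box_bump_outside\<close>)
  have "integrable (lebesgue_on (cbox a b)) f"
    using assms(2) sub by (simp add: locally_integrable_def)
  then have int: "integrable lebesgue (\<lambda>x. indicator (cbox a b) x * f x)"
    by (simp add: integrable_restrict_space)
  have z: "(LINT x|lebesgue. ?\<psi> n x * (indicator (cbox a b) x * f x)) = 0" for n
  proof -
    have "(\<lambda>x. ?\<psi> n x * (indicator (cbox a b) x * f x)) = (\<lambda>x. indicator \<Omega> x *\<^sub>R (f x * ?\<psi> n x))"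
      using sub box_subset_cbox[of a b] box_bump_outside[of "real (Suc n)" _ a b]
      by (force simp: fun_eq_iff indicator_def)
    then show ?thesis
      using zero[OF test, of n] assms(1) by (simp add: integral_restrict_space)
  qed
  have "(\<lambda>n. LINT x|lebesgue. ?\<psi> n x * (indicator (cbox a b) x * f x))
      \<longlonglongrightarrow> (LINT x|lebesgue. indicator (box a b) x * (indicator (cbox a b) x * f x))"
  proof (rule integral_dominated_convergence[where w = "\<lambda>x. norm (indicator (cbox a b) x * f x)"])
    have m: "?\<psi> n \<in> borel_measurable lebesgue" for n
      using test_integrable[OF test[of n]] by (auto intro: measurable_completion)
    then show "(\<lambda>x. ?\<psi> n x * (indicator (cbox a b) x * f x)) \<in> borel_measurable lebesgue" for n
      using int by (intro borel_measurable_times[of "?\<psi> n"]) auto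
    show "(\<lambda>x. indicator (box a b) x * (indicator (cbox a b) x * f x)) \<in> borel_measurable lebesgue"
      by (rule borel_measurable_times[OF _ borel_measurable_integrable[OF int]]) (auto intro!: borel_measurable_indicator)
    show "AE x in lebesgue. (\<lambda>n. ?\<psi> n x * (indicator (cbox a b) x * f x))
        \<longlonglongrightarrow> indicator (box a b) x * (indicator (cbox a b) x * f x)"
      by (intro AE_I2 tendsto_mult box_bump_tendsto tendsto_const)
    show "AE x in lebesgue. norm (?\<psi> n x * (indicator (cbox a b) x * f x)) \<le> norm (indicator (cbox a b) x * f x)" for n
      using box_bump_bounds[of a b "real (Suc n)"]
      by (intro AE_I2) (auto simp: abs_mult intro!: mult_left_le_one_le)
  qed (use int in auto)
  moreover have "(\<lambda>x. indicator (box a b) x * (indicator (cbox a b) x * f x)) = (\<lambda>x. indicator (box a b) x * f x)"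
    using box_subset_cbox[of a b] by (auto simp: fun_eq_iff indicator_def)
  ultimately show ?thesis using z LIMSEQ_unique[OF _ tendsto_const] by fastforce
qed

text \<open>The signed measure with density \<open>f\<close> cut off to \<open>cbox c d\<close>
  vanishes on all open boxes. These form an intersection-stable generator of the Borel sets, so the
  measure is zero and hence its density vanishes almost everywhere.\<close>

lemma AE_zero_cbox:
  fixes f :: "real^'n \<Rightarrow> real"
  assumes "open \<Omega>" "locally_integrable \<Omega> f"
    and zero: "\<And>\<psi>. \<psi> \<in> test_functions \<Omega> \<Longrightarrow> (LINT x|lebesgue_on \<Omega>. f x * \<psi> x) = 0"
    and sub: "cbox c d \<subseteq> \<Omega>"
  shows "AE x in lebesgue. x \<in> cbox c d \<longrightarrow> f x = 0"
proof -
  define h where "h x = indicator (cbox c d) x * f x" for x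
  have "integrable (lebesgue_on (cbox c d)) f"
    using assms(2) sub by (simp add: locally_integrable_def)
  then have int: "integrable lebesgue h"
    unfolding h_def by (simp add: integrable_restrict_space)
  have hbox: "(LINT x|lebesgue. indicator (box a b) x * h x) = 0" for a b
  proof -
    obtain a' b' where ab: "box a b \<inter> box c d = box a' b'"
      using box_Int_box by blast
    have AE: "AE x in lebesgue. indicator (box a b) x * h x = indicator (box a' b') x * f x"
    proof -
      have "AE x in lebesgue. x \<notin> cbox c d - box c d"
        using negligible_frontier_interval[of c d]
        by (intro AE_not_in) (simp add: negligible_iff_null_sets)
      then show ?thesis
        unfolding ab[symmetric] h_def
        by (rule AE_mp) (use box_subset_cbox[of c d] in \<open>auto simp: indicator_def\<close>)
    qed
    have fm: "(\<lambda>x. indicator (box a' b') x * f x) \<in> borel_measurable lebesgue"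
    proof -
      have "(\<lambda>x. indicator (box a' b') x * h x) = (\<lambda>x. indicator (box a' b') x * f x)"
        unfolding ab[symmetric] h_def using box_subset_cbox[of c d] by (auto simp: fun_eq_iff indicator_def)
      moreover have "(\<lambda>x. indicator (box a' b') x * h x) \<in> borel_measurable lebesgue"
        using int by (intro borel_measurable_times borel_measurable_indicator) auto
      ultimately show ?thesis by simp
    qed
    have "(LINT x|lebesgue. indicator (box a b) x * h x) = (LINT x|lebesgue. indicator (box a' b') x * f x)"
      by (rule integral_cong_AE[OF borel_measurable_times[OF _ borel_measurable_integrable[OF int]] fm AE])
        (auto intro!: borel_measurable_indicator)
    also have "\<dots> = 0"
    proof (cases "box a' b' = {}")
      case False
      \<comment> \<open>The intersection may touch the faces of \<open>cbox c d\<close>, but its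
        closure stays inside, which is what \<open>integral_box_zero\<close> requires. An empty box
        is treated separately, since its two corners are then arbitrary.\<close>
      then have "cbox a' b' = closure (box a b \<inter> box c d)" by (simp add: ab closure_box)
      also have "\<dots> \<subseteq> cbox c d"
        by (intro closure_minimal closed_cbox) (use box_subset_cbox[of c d] in auto)
      finally show ?thesis using sub by (intro integral_box_zero[OF assms(1,2) zero]) auto
    qed simp
    finally show ?thesis .
  qed
  \<comment> \<open>The argument on generators runs over Borel sets, so \<open>h\<close> is replaced
    by a Borel function equal to it almost everywhere.\<close>
  obtain g where g: "g \<in> borel_measurable lborel" "AE x in lborel. h x = g x"
    using completion_ex_borel_measurable_real[of h lborel] int by auto
  have gAE: "AE x in lebesgue. h x = g x" using g(2) by (rule AE_completion)
  have gm: "g \<in> borel_measurable lebesgue" using g(1) by (rule measurable_completion)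
  have "integrable lebesgue g"
    using int gAE gm by (subst integrable_cong_AE[of g _ h]) auto
  then have gint: "integrable lborel g" using g(1) by (simp add: integrable_completion)
  have transfer: "(LINT x:A|lborel. g x) = (LINT x|lebesgue. indicator A x * h x)"
    if "A \<in> sets borel" for A
  proof -
    have "(LINT x:A|lborel. g x) = (LINT x|lebesgue. indicator A x * g x)"
      unfolding set_lebesgue_integral_def using g(1) that by (subst integral_completion) auto
    also have "\<dots> = (LINT x|lebesgue. indicator A x * h x)"
      using int gm that gAE
      by (intro integral_cong_AE borel_measurable_times borel_measurable_indicator) auto
    finally show ?thesis .
  qed
  have gset: "set_integrable lborel A g" if "A \<in> sets borel" for A
    unfolding set_integrable_def using that gint by (intro integrable_mult_indicator) auto
  have gUNIV: "(LINT x:UNIV|lborel. g x) = 0"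
  proof -
    \<comment> \<open>The case of complements needs the integral over the whole space; as
      \<open>h\<close> vanishes off \<open>cbox c d\<close>, that is the integral over a larger open
      box.\<close>
    have "cbox c d \<subseteq> box (c - One) (d + One)"
      by (force simp: mem_box inner_diff_left inner_add_left inner_sum_left_Basis)
    then have eq: "(\<lambda>x. indicator UNIV x * h x) = (\<lambda>x. indicator (box (c - One) (d + One)) x * h x)"
      by (auto simp: fun_eq_iff h_def indicator_def)
    have "UNIV \<in> sets (borel :: (real^'n) measure)" by simp
    then show ?thesis by (simp only: transfer eq hbox)
  qed
  let ?G = "range (\<lambda>(a, b). box a b :: (real^'n) set)"
  have sets_eq: "sets borel = sigma_sets UNIV ?G" by (simp add: borel_eq_box)
  have all: "(LINT x:A|lborel. g x) = 0" if "A \<in> sigma_sets UNIV ?G" for A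
  proof -
    have "Int_stable ?G" by (auto simp: Int_stable_def box_Int_box)
    then show ?thesis
      using subset_UNIV[of ?G, unfolded Pow_UNIV[symmetric]] that
    proof (induction rule: sigma_sets_induct_disjoint)
      case (compl A)
      then have A: "A \<in> sets borel" by (simp add: sets_eq)
      have "(LINT x:A \<union> - A|lborel. g x) = (LINT x:A|lborel. g x) + (LINT x:- A|lborel. g x)"
        using A by (intro set_integral_Un gset) auto
      then show ?case using compl gUNIV by (simp add: Compl_eq_Diff_UNIV)
    next
      case (union A)
      then have A: "A i \<in> sets borel" for i by (auto simp: sets_eq)
      then have "(LINT x:(\<Union>i. A i)|lborel. g x) = (\<Sum>i. (LINT x:A i|lborel. g x))"
        using union(1) by (intro lebesgue_integral_countable_add gset) (auto simp: disjoint_family_on_def)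
      with union show ?case by simp
    qed (auto simp: transfer hbox)
  qed
  have "AE x in lborel. g x = 0"
    by (rule sigma_finite_measure.density_zero[OF sigma_finite_lborel gint], rule all) (simp add: sets_eq[symmetric])
  then have "AE x in lebesgue. g x = 0" by (rule AE_completion)
  with gAE show ?thesis
    by eventually_elim (auto simp: h_def indicator_def)
qed

lemma fundamental_lemma_calculus_of_variations:
  fixes f :: "real^'n \<Rightarrow> real"
  assumes "open \<Omega>" "locally_integrable \<Omega> f"
    and "\<And>\<psi>. \<psi> \<in> test_functions \<Omega> \<Longrightarrow> (LINT x|lebesgue_on \<Omega>. f x * \<psi> x) = 0"
  shows "AE x in lebesgue_on \<Omega>. f x = 0"
proof -
  obtain \<D> where D: "countable \<D>" "\<D> \<subseteq> Pow \<Omega>" "\<And>X. X \<in> \<D> \<Longrightarrow> \<exists>a b. X = cbox a b" "\<Union>\<D> = \<Omega>"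
    using open_countable_Union_open_cbox[OF assms(1)] by blast
  have "AE x in lebesgue. \<forall>X\<in>\<D>. x \<in> X \<longrightarrow> f x = 0"
    using D(1)
  proof (rule AE_ball_countable[THEN iffD2, rule_format])
    fix X assume X: "X \<in> \<D>"
    then obtain a b where "X = cbox a b" using D(3) by blast
    with X D(2) show "AE x in lebesgue. x \<in> X \<longrightarrow> f x = 0"
      using AE_zero_cbox[OF assms, of a b] by auto
  qed
  then have "AE x in lebesgue. x \<in> \<Omega> \<longrightarrow> f x = 0"
    by eventually_elim (use D(4) in auto)
  then show ?thesis using assms(1) by (subst AE_restrict_space_iff) auto
qed

lemma weak_deriv_unique:
  assumes "open \<Omega>" "is_weak_deriv \<Omega> \<alpha> u v" "is_weak_deriv \<Omega> \<alpha> u w"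
  shows "AE x in lebesgue_on \<Omega>. v x = w x"
proof -
  have d: "is_weak_deriv \<Omega> \<alpha> (\<lambda>x. u x - u x) (\<lambda>x. v x - w x)"
    by (rule is_weak_deriv_diff[OF assms])
  have "AE x in lebesgue_on \<Omega>. v x - w x = 0"
    by (rule fundamental_lemma_calculus_of_variations[OF assms(1)])
      (use d in \<open>auto simp: is_weak_deriv_def\<close>)
  then show ?thesis by simp
qed

text \<open>This makes every later statement independent of the choice in \<open>weak_deriv\<close>:
  any convenient representative may be used instead.\<close>

lemma weak_deriv_AE:
  assumes "open \<Omega>" "is_weak_deriv \<Omega> \<alpha> u v"
  shows "AE x in lebesgue_on \<Omega>. weak_deriv \<Omega> \<alpha> u x = v x"
  using weak_deriv_unique[OF assms(1) _ assms(2)] someI[of "is_weak_deriv \<Omega> \<alpha> u", OF assms(2)]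
  unfolding weak_deriv_def by blast

section \<open>The one-dimensional inequality\<close>

text \<open>A supporting line of the graph at \<open>y\<close>. Evaluating it at 0, where
  \<open>P\<close> vanishes, gives \<open>q \<ge> 0\<close>; then
  \<open>p * y = P y + q \<ge> 0\<close> yields the sign of the slope. For \<open>y = 0\<close>, a
  boundary point of the domain, the zero line serves.\<close>

lemma convex_affine_minorant:
  fixes P :: "real \<Rightarrow> real"
  assumes conv: "convex_on {0..} P" and nonneg: "\<And>t. t \<ge> 0 \<Longrightarrow> P t \<ge> 0" and P0: "P 0 = 0" and y: "y \<ge> 0"
  obtains p q where "p \<ge> 0" "q \<ge> 0" "P y = p * y - q" "\<And>t. t \<ge> 0 \<Longrightarrow> p * t - q \<le> P t"
proof (cases "y = 0")
  case True
  then show ?thesis using that[of 0 0] P0 nonneg by auto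
next
  case False
  with y have y: "y > 0" by simp
  \<comment> \<open>The infimum of the secant slopes to the right of \<open>y\<close>, that is, the
    right derivative.\<close>
  define p where "p = Inf ((\<lambda>t. (P y - P t) / (y - t)) ` ({y<..} \<inter> {0..}))"
  have y_int: "y \<in> interior {0..}" using y by simp
  have le: "P t \<ge> P y + p * (t - y)" if "t \<ge> 0" for t
    unfolding p_def using that by (intro convex_le_Inf_differential[OF conv y_int]) auto
  define q where "q = p * y - P y"
  have q: "q \<ge> 0" using le[of 0] P0 by (simp add: q_def)
  moreover have "p * y \<ge> 0" using q nonneg[of y] y by (simp add: q_def)
  then have "p \<ge> 0" using y by (simp add: zero_le_mult_iff)
  moreover have "p * t - q \<le> P t" if "t \<ge> 0" for t
    using le[OF that] by (simp add: q_def algebra_simps)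
  moreover have "P y = p * y - q" by (simp add: q_def)
  ultimately show ?thesis by (intro that[of p q])
qed

lemma convex_le_scaled:
  fixes P :: "real \<Rightarrow> real"
  assumes "convex_on {0..} P" "P 0 = 0" "0 \<le> c" "c \<le> 1" "t \<ge> 0"
  shows "P (c * t) \<le> c * P t"
proof -
  have "P ((1 - c) *\<^sub>R 0 + c *\<^sub>R t) \<le> (1 - c) * P 0 + c * P t"
    using assms(3-5) by (intro convex_onD[OF assms(1)]) auto
  then show ?thesis by (simp add: assms(2))
qed

lemma convex_halves:
  fixes P :: "real \<Rightarrow> real"
  assumes "convex_on {0..} P" "s \<ge> 0" "t \<ge> 0"
  shows "P (s + t) \<le> P (2 * s) / 2 + P (2 * t) / 2"
proof -
  have "P ((1 - 1 / 2) *\<^sub>R (2 * s) + (1 / 2) *\<^sub>R (2 * t)) \<le> (1 - 1 / 2) * P (2 * s) + (1 / 2) * P (2 * t)"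
    using assms(2,3) by (intro convex_onD[OF assms(1)]) auto
  then show ?thesis by simp
qed

section \<open>Pointwise estimates and measurability for Musielak functions\<close>

lemma
  assumes "phi_function \<Omega> M" "x \<in> \<Omega>"
  shows phi_nonneg: "t \<ge> 0 \<Longrightarrow> M x t \<ge> 0"
    and phi_zero: "M x 0 = 0"
    and phi_convex: "convex_on {0..} (M x)"
    and phi_mono: "0 \<le> s \<Longrightarrow> s \<le> t \<Longrightarrow> M x s \<le> M x t"
proof -
  have *: "\<forall>s\<ge>0. M x s \<ge> 0" "mono_on {0..} (M x)" "convex_on {0..} (M x)" "M x 0 = 0"
    using assms unfolding phi_function_def by blast+
  show "t \<ge> 0 \<Longrightarrow> M x t \<ge> 0" "M x 0 = 0" "convex_on {0..} (M x)" using * by blast+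
  show "0 \<le> s \<Longrightarrow> s \<le> t \<Longrightarrow> M x s \<le> M x t" by (rule mono_onD[OF *(2)]) auto
qed

text \<open>Moves a numerical factor from outside \<open>M\<close> into its argument; the factor 2
  from the two half-lines is absorbed in this way.\<close>

lemma phi_scale_le:
  assumes "phi_function \<Omega> M" "x \<in> \<Omega>" "c \<ge> 1" "t \<ge> 0"
  shows "c * M x t \<le> M x (c * t)"
proof -
  have "M x (1 / c * (c * t)) \<le> 1 / c * M x (c * t)"
    using assms(3,4) by (intro convex_le_scaled[OF phi_convex[OF assms(1,2)] phi_zero[OF assms(1,2)]]) auto
  then show ?thesis using assms(3) by (simp add: pos_le_divide_eq mult.commute)
qed

text \<open>By convexity on \<open>[t, t + 1]\<close>, a step of length \<open>\<eta>\<close> raises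
  the value by at most \<open>\<eta>\<close> times the increment over that interval. The nearby
  point is taken rational so that the measurability proof needs only countably many levels.\<close>

lemma phi_right_continuous:
  assumes "phi_function \<Omega> M" "x \<in> \<Omega>" "t \<ge> 0" "M x t < a"
  obtains r :: rat where "t < of_rat r" "M x (of_rat r) < a"
proof -
  \<comment> \<open>The summand 1 keeps the later divisor positive.\<close>
  define D where "D = M x (t + 1) - M x t + 1"
  have "D > 0" using phi_mono[OF assms(1,2), of t "t + 1"] assms(3) by (simp add: D_def)
  define \<delta> where "\<delta> = min 1 ((a - M x t) / D)"
  have \<delta>: "0 < \<delta>" "\<delta> \<le> 1" "\<delta> * D \<le> a - M x t"
    using assms(4) \<open>D > 0\<close> by (auto simp: \<delta>_def field_simps min_def)
  obtain r :: rat where r: "t < of_rat r" "of_rat r < t + \<delta>"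
    using of_rat_dense[of t "t + \<delta>"] \<delta> by auto
  define \<eta> where "\<eta> = of_rat r - t"
  have \<eta>: "0 < \<eta>" "\<eta> < \<delta>" using r by (auto simp: \<eta>_def)
  have "M x (of_rat r) \<le> (1 - \<eta>) * M x t + \<eta> * M x (t + 1)"
    using convex_onD[OF phi_convex[OF assms(1,2)], of \<eta> t "t + 1"] assms(3) \<eta> \<delta>
    by (simp add: \<eta>_def algebra_simps)
  also have "\<dots> = M x t + \<eta> * (D - 1)" by (simp add: D_def algebra_simps)
  also have "\<dots> < M x t + \<eta> * D" using \<eta> by (simp add: algebra_simps)
  also have "\<dots> \<le> M x t + \<delta> * D" using \<eta> \<open>D > 0\<close> by simp
  also have "\<dots> \<le> a" using \<delta> by simp
  finally show ?thesis using that r by blast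
qed

text \<open>Measurability of \<open>M\<close> in \<open>x\<close> is given only at fixed second
  argument. Monotonicity and right continuity reduce a sublevel set of the composition to a
  countable union, over rational \<open>r\<close> above \<open>\<bar>v x\<bar>\<close>, of sets with
  the second argument frozen at \<open>r\<close>.\<close>

lemma phi_measurable:
  fixes \<Omega> :: "(real^'n) set"
  assumes M: "phi_function \<Omega> M" and v: "v \<in> borel_measurable (lebesgue_on \<Omega>)"
  shows "(\<lambda>x. M x \<bar>v x\<bar>) \<in> borel_measurable (lebesgue_on \<Omega>)"
proof (rule borel_measurable_iff_less[THEN iffD2], rule)
  fix a
  let ?S = "lebesgue_on \<Omega>"
  have sp: "space ?S = \<Omega>" by (simp add: space_restrict_space)
  have "{x \<in> space ?S. M x \<bar>v x\<bar> < a} =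
    (\<Union>r\<in>{r::rat. 0 \<le> r}. {x \<in> space ?S. \<bar>v x\<bar> < of_rat r} \<inter> {x \<in> space ?S. M x (of_rat r) < a})"
  proof (intro set_eqI iffI)
    fix x assume x: "x \<in> {x \<in> space ?S. M x \<bar>v x\<bar> < a}"
    then have "x \<in> \<Omega>" by (simp add: sp)
    obtain r :: rat where r: "\<bar>v x\<bar> < of_rat r" "M x (of_rat r) < a"
      using phi_right_continuous[OF M \<open>x \<in> \<Omega>\<close>, of "\<bar>v x\<bar>" a] x by auto
    have "(of_rat r :: real) \<ge> 0" using r(1) by linarith
    then have "r \<ge> 0" by simp
    then show "x \<in> (\<Union>r\<in>{r::rat. 0 \<le> r}. {x \<in> space ?S. \<bar>v x\<bar> < of_rat r} \<inter> {x \<in> space ?S. M x (of_rat r) < a})"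
      using x r by blast
  next
    fix x assume "x \<in> (\<Union>r\<in>{r::rat. 0 \<le> r}. {x \<in> space ?S. \<bar>v x\<bar> < of_rat r} \<inter> {x \<in> space ?S. M x (of_rat r) < a})"
    then obtain r where r: "x \<in> space ?S" "\<bar>v x\<bar> < of_rat r" "M x (of_rat r) < a" by blast
    then have "M x \<bar>v x\<bar> \<le> M x (of_rat r)" by (intro phi_mono[OF M]) (auto simp: sp)
    with r show "x \<in> {x \<in> space ?S. M x \<bar>v x\<bar> < a}" by simp
  qed
  also have "\<dots> \<in> sets ?S"
  proof (intro sets.countable_UN'' sets.Int)
    fix r :: rat assume "r \<in> {r. 0 \<le> r}"
    then have "(\<lambda>x. M x (of_rat r)) \<in> borel_measurable ?S"
      using M by (auto simp: phi_function_def)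
    then show "{x \<in> space ?S. M x (of_rat r) < a} \<in> sets ?S" by measurable
    show "{x \<in> space ?S. \<bar>v x\<bar> < of_rat r} \<in> sets ?S" using v by measurable
  qed (rule countableI_type)
  finally show "{x \<in> space ?S. M x \<bar>v x\<bar> < a} \<in> sets ?S" .
qed

text \<open>Connects the gauge integral of the fundamental theorem with the extended nonnegative
  integral of the modular. The bound \<open>k\<close> will come from an affine minorant and may be
  negative, so its positive part is integrated.\<close>

lemma ennreal_integral_le_nn_integral:
  fixes k :: "real \<Rightarrow> real"
  assumes "continuous_on {0..L} k" "\<And>s. s \<in> {0..L} \<Longrightarrow> ennreal (k s) \<le> g s"
  shows "ennreal (integral {0..L} k) \<le> (\<integral>\<^sup>+s. indicator {0..L} s * g s \<partial>lborel)"
proof -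
  let ?k = "\<lambda>s. max 0 (k s)"
  have c: "continuous_on {0..L} ?k" using assms(1) by (intro continuous_intros)
  have si: "set_integrable lborel {0..L} ?k"
    unfolding set_integrable_def by (intro borel_integrable_compact c) auto
  have "integral {0..L} k \<le> integral {0..L} ?k"
    using assms(1) c by (intro integral_le integrable_continuous_interval) auto
  also have "\<dots> = (LINT s|lborel. indicator {0..L} s *\<^sub>R ?k s)"
    using set_borel_integral_eq_integral(2)[OF si] by (simp add: set_lebesgue_integral_def)
  finally have "ennreal (integral {0..L} k) \<le> ennreal (LINT s|lborel. indicator {0..L} s *\<^sub>R ?k s)"
    by (rule ennreal_leI)
  also have "\<dots> = (\<integral>\<^sup>+s. ennreal (indicator {0..L} s *\<^sub>R ?k s) \<partial>lborel)"
    using si unfolding set_integrable_def by (intro nn_integral_eq_integral[symmetric]) auto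
  also have "\<dots> \<le> (\<integral>\<^sup>+s. indicator {0..L} s * g s \<partial>lborel)"
  proof (rule nn_integral_mono)
    fix s
    show "ennreal (indicator {0..L} s *\<^sub>R ?k s) \<le> indicator {0..L} s * g s"
      using assms(2)[of s] by (cases "s \<in> {0..L}"; cases "k s \<ge> 0") (simp_all add: max_def)
  qed
  finally show ?thesis .
qed

text \<open>The one-dimensional core. The data \<open>d1\<close>, \<open>N1\<close> belong to the side on which \<open>M(\<cdot>,t)\<close> is no
  smaller for \<open>t \<ge> t0\<close>, the data \<open>d2\<close>, \<open>N2\<close> to the side on which it is no smaller for \<open>t < t0\<close>.
  Jensen's inequality is applied through an affine minorant of \<open>P\<close> touching at \<open>y\<close>: for
  \<open>y \<ge> t0/2\<close> the first side suffices, since the part of the derivative below \<open>t0/4\<close> contributes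
  at most \<open>t0/4 \<le> y/2\<close>; for \<open>y < t0/2\<close> the second side suffices, since the slope of the minorant
  is at most \<open>3 P(3t0/4) / (3t0/4)\<close>, which by convexity is controlled by \<open>N2\<close> above \<open>3t0/4\<close>.\<close>

lemma one_dimensional_bound:
  fixes P :: "real \<Rightarrow> real" and N1 N2 :: "real \<Rightarrow> real \<Rightarrow> real"
  assumes P: "convex_on {0..} P" "\<And>t. t \<ge> 0 \<Longrightarrow> P t \<ge> 0" "P 0 = 0"
      "\<And>s t. 0 \<le> s \<Longrightarrow> s \<le> t \<Longrightarrow> P s \<le> P t"
    and L: "L > 0" and t0: "t0 \<ge> 0" and y: "y \<ge> 0"
    and d1: "continuous_on {0..L} d1" "\<And>s. d1 s \<ge> 0" "y \<le> integral {0..L} d1"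
    and d2: "continuous_on {0..L} d2" "\<And>s. d2 s \<ge> 0" "y \<le> integral {0..L} d2"
    and N1: "\<And>s t. s \<in> {0..L} \<Longrightarrow> d1 s \<noteq> 0 \<Longrightarrow> t \<ge> t0 \<Longrightarrow> P t \<le> N1 s t"
    and N2: "\<And>s t. s \<in> {0..L} \<Longrightarrow> d2 s \<noteq> 0 \<Longrightarrow> 0 \<le> t \<Longrightarrow> t < t0 \<Longrightarrow> P t \<le> N2 s t"
      "\<And>s. s \<in> {0..L} \<Longrightarrow> d2 s \<noteq> 0 \<Longrightarrow> convex_on {0..} (N2 s)"
      "\<And>s. s \<in> {0..L} \<Longrightarrow> d2 s \<noteq> 0 \<Longrightarrow> N2 s 0 = 0"
      "\<And>s a b. s \<in> {0..L} \<Longrightarrow> d2 s \<noteq> 0 \<Longrightarrow> 0 \<le> a \<Longrightarrow> a \<le> b \<Longrightarrow> N2 s a \<le> N2 s b"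
    and g1: "\<And>s. s \<in> {0..L} \<Longrightarrow> d1 s \<noteq> 0 \<Longrightarrow> ennreal (N1 s (4 * L * d1 s)) \<le> g1 s"
    and g2: "\<And>s. s \<in> {0..L} \<Longrightarrow> d2 s \<noteq> 0 \<Longrightarrow> ennreal (N2 s (4 * L * d2 s)) \<le> g2 s"
  shows "ennreal (L * P y) \<le> (\<integral>\<^sup>+s. indicator {0..L} s * g1 s \<partial>lborel) + (\<integral>\<^sup>+s. indicator {0..L} s * g2 s \<partial>lborel)"
proof -
  obtain p q where pq: "p \<ge> 0" "q \<ge> 0" "P y = p * y - q" "\<And>t. t \<ge> 0 \<Longrightarrow> p * t - q \<le> P t"
    using convex_affine_minorant[OF P(1-3) y] by metis
  have int_affine: "integral {0..L} (\<lambda>s. A * d s - B) = A * integral {0..L} d - B * L"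
    if "continuous_on {0..L} d" for A B :: real and d
    using that L by (simp add: Henstock_Kurzweil_Integration.integral_diff integrable_continuous_interval
        continuous_intros)
  show ?thesis
  proof (cases "y \<ge> t0 / 2")
    case True
    \<comment> \<open>Adding \<open>y \<ge> t0 / 2\<close> to the bound for \<open>y\<close> gives
      \<open>y \<le> 2 * integral {0..L} d1 - t0 / 2\<close>. The subtracted \<open>t0 / 2\<close>
      makes \<open>k s\<close> nonpositive wherever \<open>4 * L * d1 s < t0\<close>, so
      \<open>N1\<close> is used only in its admissible range.\<close>
    define k where "k s = 2 * p * L * d1 s - (p * (t0 / 2) + q)" for s
    have "L * P y = p * L * y - q * L" by (simp add: pq(3) algebra_simps)
    also have "\<dots> \<le> p * L * (2 * integral {0..L} d1 - t0 / 2) - q * L"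
    proof -
      have "y \<le> 2 * integral {0..L} d1 - t0 / 2" using True d1(3) by linarith
      from mult_left_mono[OF this, of "p * L"] show ?thesis using pq(1) L by simp
    qed
    also have "\<dots> = integral {0..L} k"
      unfolding k_def by (subst int_affine[OF d1(1)]) (simp add: algebra_simps)
    finally have "ennreal (L * P y) \<le> ennreal (integral {0..L} k)" by (rule ennreal_leI)
    also have "\<dots> \<le> (\<integral>\<^sup>+s. indicator {0..L} s * g1 s \<partial>lborel)"
    proof (rule ennreal_integral_le_nn_integral)
      show "continuous_on {0..L} k" unfolding k_def using d1(1) by (intro continuous_intros)
      fix s assume s: "s \<in> {0..L}"
      let ?h = "L * d1 s"
      have k: "k s = p * (2 * ?h - t0 / 2) - q" by (simp add: k_def algebra_simps)
      show "ennreal (k s) \<le> g1 s"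
      proof (cases "4 * ?h \<ge> t0 \<and> d1 s \<noteq> 0")
        case True
        then have "k s \<le> P (2 * ?h - t0 / 2)" unfolding k by (intro pq) auto
        also have "\<dots> \<le> P (4 * ?h)" using True t0 d1(2)[of s] L by (intro P(4)) auto
        also have "\<dots> \<le> N1 s (4 * L * d1 s)" using N1[of s "4 * ?h"] True s by (simp add: mult.assoc)
        finally have "ennreal (k s) \<le> ennreal (N1 s (4 * L * d1 s))" by (rule ennreal_leI)
        also have "\<dots> \<le> g1 s" using g1[OF s] True by simp
        finally show ?thesis .
      next
        case False
        then have "2 * ?h - t0 / 2 \<le> 0" using t0 by auto
        from mult_nonneg_nonpos[OF pq(1) this] have "k s \<le> 0" unfolding k using pq(2) by linarith
        then show ?thesis by (simp add: ennreal_neg)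
      qed
    qed
    also have "\<dots> \<le> \<dots> + (\<integral>\<^sup>+s. indicator {0..L} s * g2 s \<partial>lborel)" by simp
    finally show ?thesis .
  next
    case False
    \<comment> \<open>A level below \<open>t0\<close>, so that \<open>N2\<close> still dominates
      \<open>P\<close> there, and above \<open>y\<close> by at least \<open>t0 / 4\<close>, so that
      the slope \<open>p\<close> is bounded by the increment of \<open>P\<close> up to it.\<close>
    define t1 where "t1 = 3 / 4 * t0"
    have t0': "t0 > 0" using False y by simp
    have "t0 / 4 \<le> t1 - y" using False by (simp add: t1_def)
    from mult_left_mono[OF this pq(1)] have "p * (t0 / 4) \<le> p * (t1 - y)" .
    also have "\<dots> \<le> P t1 - P y" using pq(4)[of t1] pq(3) t0 by (simp add: t1_def algebra_simps)
    also have "\<dots> \<le> P t1" using P(2)[OF y] by simp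
    finally have slope: "p * t1 \<le> 3 * P t1" by (simp add: t1_def)
    define k where "k s = p * L * d2 s - q" for s
    have "L * P y = p * L * y - q * L" by (simp add: pq(3) algebra_simps)
    also have "\<dots> \<le> p * L * integral {0..L} d2 - q * L"
      using mult_left_mono[OF d2(3), of "p * L"] pq(1) L by simp
    also have "\<dots> = integral {0..L} k" unfolding k_def by (subst int_affine[OF d2(1)]) simp
    finally have "ennreal (L * P y) \<le> ennreal (integral {0..L} k)" by (rule ennreal_leI)
    also have "\<dots> \<le> (\<integral>\<^sup>+s. indicator {0..L} s * g2 s \<partial>lborel)"
    proof (rule ennreal_integral_le_nn_integral)
      show "continuous_on {0..L} k" unfolding k_def using d2(1) by (intro continuous_intros)
      fix s assume s: "s \<in> {0..L}"
      let ?h = "L * d2 s"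
      have h: "?h \<ge> 0" using L d2(2)[of s] by simp
      show "ennreal (k s) \<le> g2 s"
      proof (cases "d2 s = 0")
        case True
        then have "k s \<le> 0" unfolding k_def using pq(2) by simp
        then show ?thesis by (simp add: ennreal_neg)
      next
        case ne: False
        have "k s \<le> N2 s (4 * ?h)"
        proof (cases "4 * ?h < t0")
          case True
          have "k s \<le> P ?h" using pq(4)[OF h] by (simp add: k_def mult.assoc)
          also have "\<dots> \<le> P (4 * ?h)" using h by (intro P(4)) auto
          also have "\<dots> \<le> N2 s (4 * ?h)" using True h by (intro N2(1)[OF s ne]) auto
          finally show ?thesis .
        next
          case False
          have t1: "t1 > 0" "t1 < t0" "t1 \<le> 3 * ?h" using False t0' by (auto simp: t1_def)
          have "(p * ?h) * t1 = (p * t1) * ?h" by simp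
          also have "\<dots> \<le> (3 * P t1) * ?h" using slope h by (rule mult_right_mono)
          also have "\<dots> = P t1 * (3 * ?h)" by simp
          also have "\<dots> \<le> N2 s t1 * (3 * ?h)"
            using N2(1)[OF s ne, of t1] t1 h by (intro mult_right_mono) auto
          \<comment> \<open>The quotient \<open>N2 s t / t\<close> is nondecreasing in
            \<open>t\<close> by convexity and vanishing at 0. This transports the bound from
            \<open>t1\<close>, where \<open>P\<close> and \<open>N2\<close> are comparable, to
            \<open>3 * ?h\<close>, where they need not be.\<close>
          also have "N2 s t1 * (3 * ?h) \<le> N2 s (3 * ?h) * t1"
          proof -
            define H where "H = 3 * ?h"
            have H: "H > 0" "t1 \<le> H" using t1 by (simp_all add: H_def)
            have "N2 s ((t1 / H) * H) \<le> (t1 / H) * N2 s H"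
              using t1 H by (intro convex_le_scaled N2(2,3)[OF s ne]) auto
            then have "N2 s t1 \<le> t1 * N2 s H / H" using H by simp
            then have "N2 s t1 * H \<le> N2 s H * t1" using H by (simp add: pos_le_divide_eq mult.commute)
            then show ?thesis unfolding H_def .
          qed
          finally have "p * ?h \<le> N2 s (3 * ?h)" using t1(1) by (rule mult_right_le_imp_le)
          also have "\<dots> \<le> N2 s (4 * ?h)" using h by (intro N2(4)[OF s ne]) auto
          finally show ?thesis using pq(2) by (simp add: k_def mult.assoc)
        qed
        then have "k s \<le> N2 s (4 * L * d2 s)" by (simp add: mult.assoc)
        then have "ennreal (k s) \<le> ennreal (N2 s (4 * L * d2 s))" by (rule ennreal_leI)
        also have "\<dots> \<le> g2 s" by (rule g2[OF s ne])
        finally show ?thesis .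
      qed
    qed
    also have "\<dots> \<le> (\<integral>\<^sup>+s. indicator {0..L} s * g1 s \<partial>lborel) + \<dots>" by simp
    finally show ?thesis .
  qed
qed

text \<open>The segments through a given point may meet a null set badly, so domination has to hold
  everywhere and not just almost everywhere; the value \<open>top\<close> on a Borel null set
  achieves this without changing the integral. A Borel majorant can then be composed with
  translations and used in Tonelli's theorem.\<close>

lemma borel_majorant:
  fixes g :: "'a::euclidean_space \<Rightarrow> ennreal"
  assumes "g \<in> borel_measurable lebesgue"
  obtains G where "G \<in> borel_measurable borel" "\<And>x. g x \<le> G x" "(\<integral>\<^sup>+x. G x \<partial>lborel) = (\<integral>\<^sup>+x. g x \<partial>lebesgue)"
proof -
  obtain g' where g': "g' \<in> borel_measurable lborel" "AE x in lborel. g x = g' x"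
    using completion_ex_borel_measurable[OF assms] by blast
  from AE_E[OF g'(2)] obtain N where N: "{x \<in> space lborel. \<not> g x = g' x} \<subseteq> N" "emeasure lborel N = 0" "N \<in> sets lborel"
    by blast
  let ?G = "\<lambda>x. if x \<in> N then top else g' x"
  have "AE x in lborel. x \<notin> N" using N by (intro AE_not_in) auto
  then have "AE x in lborel. ?G x = g x" using g'(2) by eventually_elim simp
  then have "(\<integral>\<^sup>+x. ?G x \<partial>lborel) = (\<integral>\<^sup>+x. g x \<partial>lborel)" by (rule nn_integral_cong_AE)
  moreover have "?G \<in> borel_measurable borel"
    using g'(1) N(3) by (intro measurable_If_set) auto
  moreover have "g x \<le> ?G x" for x
    using N(1) by (cases "x \<in> N") (auto intro: eq_refl)
  ultimately show ?thesis using that[of ?G] by (simp add: nn_integral_completion)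
qed

section \<open>The inequality for test functions\<close>

lemma upd_coord_eq: "upd_coord x i (x $ i + s) = x + s *\<^sub>R axis i 1"
  by (simp add: upd_coord_def vec_eq_iff axis_def)

lemma
  fixes \<Omega> :: "(real^'n) set"
  assumes "\<Omega> \<subseteq> {x. x $ i \<in> {a..b}}" "x \<in> \<Omega>" "x + s *\<^sub>R axis i 1 \<in> \<Omega>" "s \<ge> 0"
  shows nondecreasing_coordD: "nondecreasing_coord \<Omega> i a b f \<Longrightarrow> f x \<le> f (x + s *\<^sub>R axis i 1)"
    and nonincreasing_coordD: "nonincreasing_coord \<Omega> i a b f \<Longrightarrow> f (x + s *\<^sub>R axis i 1) \<le> f x"
proof -
  let ?S = "{r\<in>{a..b}. upd_coord x i r \<in> \<Omega>}"
  have x: "upd_coord x i (x $ i) = x" using upd_coord_eq[of x i 0] by simp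
  have "(x + s *\<^sub>R axis i 1) $ i = x $ i + s" by (simp add: axis_def)
  then have in_S: "x $ i \<in> ?S" "x $ i + s \<in> ?S"
    using assms x upd_coord_eq[of x i s] by auto
  show "f x \<le> f (x + s *\<^sub>R axis i 1)" if "nondecreasing_coord \<Omega> i a b f"
  proof -
    have "mono_on ?S (\<lambda>r. f (upd_coord x i r))" using that by (simp add: nondecreasing_coord_def)
    from mono_onD[OF this in_S] assms(4) show ?thesis by (simp add: x upd_coord_eq)
  qed
  show "f (x + s *\<^sub>R axis i 1) \<le> f x" if "nonincreasing_coord \<Omega> i a b f"
  proof -
    have "antimono_on ?S (\<lambda>r. f (upd_coord x i r))" using that by (simp add: nonincreasing_coord_def)
    from monotone_onD[OF this in_S] assms(4) show ?thesis by (simp add: x upd_coord_eq)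
  qed
qed

text \<open>\<open>Yinf_condition\<close> is the case \<open>t0 = 0\<close>; the sign \<open>\<sigma>\<close> selects the alternative.\<close>

definition Y_along :: "(real^'n) set \<Rightarrow> 'n \<Rightarrow> real \<Rightarrow> real \<Rightarrow> (real^'n \<Rightarrow> real \<Rightarrow> real) \<Rightarrow> bool" where
  "Y_along \<Omega> i \<sigma> t0 M \<longleftrightarrow> \<sigma> \<in> {1, -1} \<and> t0 \<ge> 0 \<and> (\<forall>x\<in>\<Omega>. \<forall>s\<ge>0.
     (x + (\<sigma> * s) *\<^sub>R axis i 1 \<in> \<Omega> \<longrightarrow> (\<forall>t. 0 \<le> t \<and> t < t0 \<longrightarrow> M x t \<le> M (x + (\<sigma> * s) *\<^sub>R axis i 1) t)) \<and>
     (x + (- \<sigma> * s) *\<^sub>R axis i 1 \<in> \<Omega> \<longrightarrow> (\<forall>t\<ge>t0. M x t \<le> M (x + (- \<sigma> * s) *\<^sub>R axis i 1) t)))"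

lemma Y_alongI:
  fixes \<Omega> :: "(real^'n) set"
  assumes sub: "\<Omega> \<subseteq> {x. x $ i \<in> {a..b}}" and t0: "t0 \<ge> 0"
  shows "(\<And>t. 0 \<le> t \<Longrightarrow> t < t0 \<Longrightarrow> nondecreasing_coord \<Omega> i a b (\<lambda>x. M x t)) \<Longrightarrow>
      (\<And>t. t \<ge> t0 \<Longrightarrow> nonincreasing_coord \<Omega> i a b (\<lambda>x. M x t)) \<Longrightarrow> Y_along \<Omega> i 1 t0 M"
    and "(\<And>t. 0 \<le> t \<Longrightarrow> t < t0 \<Longrightarrow> nonincreasing_coord \<Omega> i a b (\<lambda>x. M x t)) \<Longrightarrow>
      (\<And>t. t \<ge> t0 \<Longrightarrow> nondecreasing_coord \<Omega> i a b (\<lambda>x. M x t)) \<Longrightarrow> Y_along \<Omega> i (-1) t0 M"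
proof -
  have shift_back: "(x + (- s) *\<^sub>R axis i 1) + s *\<^sub>R axis i 1 = x" for x :: "real^'n" and s by simp
  have nd: "M x t \<le> M (x + s *\<^sub>R axis i 1) t"
    if "nondecreasing_coord \<Omega> i a b (\<lambda>x. M x t)" "x \<in> \<Omega>" "x + s *\<^sub>R axis i 1 \<in> \<Omega>" "s \<ge> 0" for x s t
    using nondecreasing_coordD[OF sub that(2-4,1)] .
  have ni: "M x t \<le> M (x + (- s) *\<^sub>R axis i 1) t"
    if "nonincreasing_coord \<Omega> i a b (\<lambda>x. M x t)" "x \<in> \<Omega>" "x + (- s) *\<^sub>R axis i 1 \<in> \<Omega>" "s \<ge> 0" for x s t
    using nonincreasing_coordD[OF sub that(3) _ that(4,1)] that(2) unfolding shift_back by simp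
  show "Y_along \<Omega> i 1 t0 M"
    if "\<And>t. 0 \<le> t \<Longrightarrow> t < t0 \<Longrightarrow> nondecreasing_coord \<Omega> i a b (\<lambda>x. M x t)"
      "\<And>t. t \<ge> t0 \<Longrightarrow> nonincreasing_coord \<Omega> i a b (\<lambda>x. M x t)"
    unfolding Y_along_def using t0 nd[OF that(1)] ni[OF that(2)] by auto
  show "Y_along \<Omega> i (-1) t0 M"
    if "\<And>t. 0 \<le> t \<Longrightarrow> t < t0 \<Longrightarrow> nonincreasing_coord \<Omega> i a b (\<lambda>x. M x t)"
      "\<And>t. t \<ge> t0 \<Longrightarrow> nondecreasing_coord \<Omega> i a b (\<lambda>x. M x t)"
    unfolding Y_along_def using t0 ni[OF that(1)] nd[OF that(2)] by auto
qed

lemma Y_condition_along: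
  assumes "Y_condition \<Omega> M"
  obtains i \<sigma> t0 where "Y_along \<Omega> i \<sigma> t0 M"
proof -
  obtain i a b where sub: "\<Omega> \<subseteq> {x. x $ i \<in> {a..b}}"
    and Y: "Y0_condition \<Omega> i a b M \<or> Yinf_condition \<Omega> i a b M"
    using assms unfolding Y_condition_def by blast
  from Y show ?thesis
  proof
    assume "Y0_condition \<Omega> i a b M"
    then show ?thesis
      unfolding Y0_condition_def using Y_alongI[OF sub] that by metis
  next
    assume "Yinf_condition \<Omega> i a b M"
    then show ?thesis
      unfolding Yinf_condition_def using Y_alongI[OF sub order_refl] that by (metis leD)
  qed
qed

lemma abs_le_integral_partial_deriv:
  fixes f :: "real^'n \<Rightarrow> real"
  assumes f: "smooth f" and L: "L > 0" and \<sigma>: "\<sigma> \<in> {1, -1}" and z: "f (x + (\<sigma> * L) *\<^sub>R axis i 1) = 0"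
  shows "continuous_on {0..L} (\<lambda>s. \<bar>partial_deriv i f (x + (\<sigma> * s) *\<^sub>R axis i 1)\<bar>)" (is ?cont)
    and "\<bar>f x\<bar> \<le> integral {0..L} (\<lambda>s. \<bar>partial_deriv i f (x + (\<sigma> * s) *\<^sub>R axis i 1)\<bar>)"
proof -
  let ?d = "\<lambda>s. partial_deriv i f (x + (\<sigma> * s) *\<^sub>R axis i 1)"
  have c: "continuous_on {0..L} ?d"
    by (intro continuous_on_compose2[OF smooth_continuous[OF smooth_partial_deriv[OF f]]] continuous_intros) auto
  then show ?cont by (intro continuous_intros)
  have D: "((\<lambda>s. f (x + (\<sigma> * s) *\<^sub>R axis i 1)) has_vector_derivative ?d s * \<sigma>) (at s within {0..L})" for s
  proof -
    have "((\<lambda>s. f (x + s *\<^sub>R axis i 1)) has_real_derivative ?d s) (at (\<sigma> * s))"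
      by (rule has_real_derivative_along_axis[OF smooth_differentiable[OF f]])
    moreover have "((\<lambda>s. \<sigma> * s) has_real_derivative \<sigma>) (at s within {0..L})"
      by (auto intro!: derivative_eq_intros)
    ultimately have "((\<lambda>s. f (x + (\<sigma> * s) *\<^sub>R axis i 1)) has_real_derivative ?d s * \<sigma>) (at s within {0..L})"
      by (rule DERIV_chain2)
    then show ?thesis by (simp add: has_real_derivative_iff_has_vector_derivative)
  qed
  have "((\<lambda>s. ?d s * \<sigma>) has_integral (f (x + (\<sigma> * L) *\<^sub>R axis i 1) - f (x + (\<sigma> * 0) *\<^sub>R axis i 1))) {0..L}"
    using L D by (intro fundamental_theorem_of_calculus) auto
  from integral_unique[OF this] have "integral {0..L} (\<lambda>s. ?d s * \<sigma>) = - f x"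
    unfolding z by simp
  then have "\<bar>f x\<bar> = norm (integral {0..L} (\<lambda>s. ?d s * \<sigma>))" by simp
  also have "\<dots> \<le> integral {0..L} (\<lambda>s. \<bar>?d s\<bar>)"
    using c \<sigma> by (intro integral_norm_bound_integral integrable_continuous_interval continuous_intros)
      (auto simp: abs_mult)
  finally show "\<bar>f x\<bar> \<le> integral {0..L} (\<lambda>s. \<bar>?d s\<bar>)" .
qed

text \<open>The segments may leave \<open>\<Omega>\<close>, where nothing is known about
  \<open>M\<close>. There the derivative of \<open>f\<close> vanishes, which is why the
  one-dimensional hypotheses are only required at parameters with nonzero derivative.\<close>

lemma pointwise_bound:
  fixes f :: "real^'n \<Rightarrow> real"
  assumes M: "phi_function \<Omega> M" and Y: "Y_along \<Omega> i \<sigma> t0 M"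
    and f: "f \<in> test_functions \<Omega>" and x: "x \<in> \<Omega>"
    and L: "L > 0" "\<And>x y. x \<in> \<Omega> \<Longrightarrow> y \<in> \<Omega> \<Longrightarrow> dist x y < L"
    and G: "\<And>z. z \<in> \<Omega> \<Longrightarrow> ennreal (M z (4 * L * \<bar>partial_deriv i f z\<bar>)) \<le> G z"
  shows "ennreal (L * M x \<bar>f x\<bar>) \<le>
    (\<integral>\<^sup>+s. indicator {0..L} s * G (x + (- \<sigma> * s) *\<^sub>R axis i 1) \<partial>lborel) +
    (\<integral>\<^sup>+s. indicator {0..L} s * G (x + (\<sigma> * s) *\<^sub>R axis i 1) \<partial>lborel)"
proof -
  have \<sigma>: "\<sigma> \<in> {1, -1}" "- \<sigma> \<in> {1, -1}" and t0: "t0 \<ge> 0" using Y by (auto simp: Y_along_def)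
  \<comment> \<open>A displacement of length \<open>L\<close> exceeds all distances in
    \<open>\<Omega>\<close>, so the end point lies outside.\<close>
  have out: "f (x + (\<tau> * L) *\<^sub>R axis i 1) = 0" if "\<tau> \<in> {1, -1}" for \<tau>
  proof -
    have "dist x (x + (\<tau> * L) *\<^sub>R axis i 1) = L"
      using that L(1) by (auto simp: dist_norm)
    then have "x + (\<tau> * L) *\<^sub>R axis i 1 \<notin> \<Omega>" using L(2)[OF x, of "x + (\<tau> * L) *\<^sub>R axis i 1"] by auto
    then show ?thesis using f by (metis subsetD test_functions_compactE)
  qed
  let ?d = "\<lambda>\<tau> s. \<bar>partial_deriv i f (x + (\<tau> * s) *\<^sub>R axis i 1)\<bar>"
  have inside: "x + (\<tau> * s) *\<^sub>R axis i 1 \<in> \<Omega>" if "?d \<tau> s \<noteq> 0" for \<tau> s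
    using that test_partial_deriv[OF f, of i] by (metis abs_0 subsetD test_functions_compactE)
  have sm: "smooth f" using f by (rule test_functions_smooth)
  show ?thesis
  proof (rule one_dimensional_bound[where P = "M x" and y = "\<bar>f x\<bar>" and L = L and ?t0.0 = t0 and ?d1.0 = "?d (- \<sigma>)" and ?d2.0 = "?d \<sigma>"
        and ?N1.0 = "\<lambda>s. M (x + (- \<sigma> * s) *\<^sub>R axis i 1)" and ?N2.0 = "\<lambda>s. M (x + (\<sigma> * s) *\<^sub>R axis i 1)"])
    show "convex_on {0..} (M x)" "\<And>t. 0 \<le> t \<Longrightarrow> 0 \<le> M x t" "M x 0 = 0"
      "\<And>s t. 0 \<le> s \<Longrightarrow> s \<le> t \<Longrightarrow> M x s \<le> M x t"
      using phi_convex[OF M x] phi_nonneg[OF M x] phi_zero[OF M x] phi_mono[OF M x] by blast+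
    show "L > 0" "t0 \<ge> 0" "\<bar>f x\<bar> \<ge> 0" using L t0 by auto
    show "continuous_on {0..L} (?d (- \<sigma>))" "\<bar>f x\<bar> \<le> integral {0..L} (?d (- \<sigma>))"
      by (rule abs_le_integral_partial_deriv[OF sm L(1) \<sigma>(2) out[OF \<sigma>(2)]])+
    show "continuous_on {0..L} (?d \<sigma>)" "\<bar>f x\<bar> \<le> integral {0..L} (?d \<sigma>)"
      by (rule abs_le_integral_partial_deriv[OF sm L(1) \<sigma>(1) out[OF \<sigma>(1)]])+
    show "0 \<le> ?d (- \<sigma>) s" "0 \<le> ?d \<sigma> s" for s by simp_all
  next
    fix s t assume "s \<in> {0..L}" "?d (- \<sigma>) s \<noteq> 0" "t \<ge> t0"
    then show "M x t \<le> M (x + (- \<sigma> * s) *\<^sub>R axis i 1) t"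
      using Y x inside[of "- \<sigma>" s] unfolding Y_along_def by auto
  next
    fix s t assume "s \<in> {0..L}" "?d \<sigma> s \<noteq> 0" "0 \<le> t" "t < t0"
    then show "M x t \<le> M (x + (\<sigma> * s) *\<^sub>R axis i 1) t"
      using Y x inside[of \<sigma> s] unfolding Y_along_def by auto
  next
    fix s assume s: "s \<in> {0..L}" "?d \<sigma> s \<noteq> 0"
    note z = inside[OF s(2)]
    show "convex_on {0..} (M (x + (\<sigma> * s) *\<^sub>R axis i 1))" by (rule phi_convex[OF M z])
    show "M (x + (\<sigma> * s) *\<^sub>R axis i 1) 0 = 0" by (rule phi_zero[OF M z])
    show "0 \<le> a \<Longrightarrow> a \<le> b \<Longrightarrow> M (x + (\<sigma> * s) *\<^sub>R axis i 1) a \<le> M (x + (\<sigma> * s) *\<^sub>R axis i 1) b" for a b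
      by (rule phi_mono[OF M z])
    show "ennreal (M (x + (\<sigma> * s) *\<^sub>R axis i 1) (4 * L * ?d \<sigma> s)) \<le> G (x + (\<sigma> * s) *\<^sub>R axis i 1)"
      by (rule G[OF z])
  next
    fix s assume s: "s \<in> {0..L}" "?d (- \<sigma>) s \<noteq> 0"
    show "ennreal (M (x + (- \<sigma> * s) *\<^sub>R axis i 1) (4 * L * ?d (- \<sigma>) s)) \<le> G (x + (- \<sigma> * s) *\<^sub>R axis i 1)"
      by (rule G[OF inside[OF s(2)]])
  qed
qed

text \<open>After exchanging the integrals every shift contributes the same amount. The resulting
  factor \<open>L\<close> cancels the one in front of \<open>M x \<bar>f x\<bar>\<close> in the
  pointwise bound.\<close>

lemma nn_integral_translation_average:
  fixes G :: "real^'n \<Rightarrow> ennreal"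
  assumes G: "G \<in> borel_measurable borel" and "L \<ge> 0"
  shows "(\<lambda>x. \<integral>\<^sup>+s. indicator {0..L} s * G (x + (\<tau> * s) *\<^sub>R e) \<partial>lborel) \<in> borel_measurable borel"
    and "(\<integral>\<^sup>+x. (\<integral>\<^sup>+s. indicator {0..L} s * G (x + (\<tau> * s) *\<^sub>R e) \<partial>lborel) \<partial>lborel) = ennreal L * (\<integral>\<^sup>+x. G x \<partial>lborel)"
proof -
  let ?F = "\<lambda>(x, s). indicator {0..L} s * G (x + (\<tau> * s) *\<^sub>R e)"
  note [measurable] = G
  have m: "?F \<in> borel_measurable (lborel \<Otimes>\<^sub>M lborel)" by measurable
  show "(\<lambda>x. \<integral>\<^sup>+s. indicator {0..L} s * G (x + (\<tau> * s) *\<^sub>R e) \<partial>lborel) \<in> borel_measurable borel"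
    by measurable
  have "(\<integral>\<^sup>+x. (\<integral>\<^sup>+s. indicator {0..L} s * G (x + (\<tau> * s) *\<^sub>R e) \<partial>lborel) \<partial>lborel)
    = (\<integral>\<^sup>+s. (\<integral>\<^sup>+x. indicator {0..L} s * G (x + (\<tau> * s) *\<^sub>R e) \<partial>lborel) \<partial>lborel)"
    using lborel_pair.Fubini'[OF m] by simp
  also have "\<dots> = (\<integral>\<^sup>+s. indicator {0..L} s * (\<integral>\<^sup>+x. G x \<partial>lborel) \<partial>(lborel :: real measure))"
  proof (rule nn_integral_cong)
    fix s :: real
    have "(\<integral>\<^sup>+x. G x \<partial>distr lborel borel ((+) ((\<tau> * s) *\<^sub>R e))) = (\<integral>\<^sup>+x. G ((\<tau> * s) *\<^sub>R e + x) \<partial>lborel)"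
      by (rule nn_integral_distr) measurable
    then have "(\<integral>\<^sup>+x. G (x + (\<tau> * s) *\<^sub>R e) \<partial>lborel) = (\<integral>\<^sup>+x. G x \<partial>lborel)"
      by (simp add: lborel_distr_plus add.commute)
    then show "(\<integral>\<^sup>+x. indicator {0..L} s * G (x + (\<tau> * s) *\<^sub>R e) \<partial>lborel) = indicator {0..L} s * (\<integral>\<^sup>+x. G x \<partial>lborel)"
      by (simp add: nn_integral_cmult)
  qed
  also have "\<dots> = ennreal L * (\<integral>\<^sup>+x. G x \<partial>lborel)"
    using \<open>L \<ge> 0\<close> by (simp add: nn_integral_multc)
  finally show "(\<integral>\<^sup>+x. (\<integral>\<^sup>+s. indicator {0..L} s * G (x + (\<tau> * s) *\<^sub>R e) \<partial>lborel) \<partial>lborel) = ennreal L * (\<integral>\<^sup>+x. G x \<partial>lborel)" .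
qed

lemma phi_measurable_scaled:
  assumes "phi_function \<Omega> M" "v \<in> borel_measurable (lebesgue_on \<Omega>)" "c \<ge> 0"
  shows "(\<lambda>x. M x (c * \<bar>v x\<bar>)) \<in> borel_measurable (lebesgue_on \<Omega>)"
  using phi_measurable[OF assms(1), of "\<lambda>x. c * v x"] assms(2,3) by (simp add: abs_mult)

lemma test_measurable: "f \<in> test_functions \<Omega> \<Longrightarrow> f \<in> borel_measurable (lebesgue_on S)"
  using borel_measurable_integrable[OF test_integrable]
  by (intro measurable_restrict_space1 measurable_completion) auto

lemma modular_test_poincare:
  fixes f :: "real^'n \<Rightarrow> real"
  assumes M: "phi_function \<Omega> M" and Y: "Y_along \<Omega> i \<sigma> t0 M"
    and \<Omega>: "open \<Omega>" and f: "f \<in> test_functions \<Omega>"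
    and L: "L > 0" "\<And>x y. x \<in> \<Omega> \<Longrightarrow> y \<in> \<Omega> \<Longrightarrow> dist x y < L"
  shows "modular \<Omega> M f \<le> modular \<Omega> M (\<lambda>x. 8 * L * partial_deriv i f x)"
proof -
  let ?e = "axis i 1 :: real^'n"
  define g where "g x = ennreal (M x (4 * L * \<bar>partial_deriv i f x\<bar>)) * indicator \<Omega> x" for x
  have \<Omega>s: "\<Omega> \<inter> space lebesgue \<in> sets lebesgue" using \<Omega> by auto
  have "(\<lambda>x. ennreal (M x (4 * L * \<bar>partial_deriv i f x\<bar>))) \<in> borel_measurable (lebesgue_on \<Omega>)"
    using phi_measurable_scaled[OF M test_measurable[OF test_partial_deriv[OF f]]] L(1) by auto
  then have "g \<in> borel_measurable lebesgue"
    unfolding g_def by (subst (asm) borel_measurable_restrict_space_iff_ennreal[OF \<Omega>s])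
  then obtain G where G: "G \<in> borel_measurable borel" "\<And>x. g x \<le> G x"
    "(\<integral>\<^sup>+x. G x \<partial>lborel) = (\<integral>\<^sup>+x. g x \<partial>lebesgue)" using borel_majorant by blast
  define H where "H \<tau> x = (\<integral>\<^sup>+s. indicator {0..L} s * G (x + (\<tau> * s) *\<^sub>R ?e) \<partial>lborel)" for \<tau> x
  have Hm: "H \<tau> \<in> borel_measurable lborel" for \<tau>
    unfolding H_def using nn_integral_translation_average(1)[OF G(1), of L \<tau> ?e] L(1) by simp
  have HI: "(\<integral>\<^sup>+x. H \<tau> x \<partial>lborel) = ennreal L * (\<integral>\<^sup>+x. G x \<partial>lborel)" for \<tau>
    unfolding H_def using L(1) by (intro nn_integral_translation_average(2) G) auto
  have fm: "(\<lambda>x. ennreal (M x \<bar>f x\<bar>)) \<in> borel_measurable (lebesgue_on \<Omega>)"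
    using phi_measurable[OF M test_measurable[OF f]] by auto
  have "ennreal L * modular \<Omega> M f = (\<integral>\<^sup>+x. ennreal L * ennreal (M x \<bar>f x\<bar>) \<partial>lebesgue_on \<Omega>)"
    unfolding modular_def using fm by (rule nn_integral_cmult[symmetric])
  also have "\<dots> = (\<integral>\<^sup>+x. ennreal L * ennreal (M x \<bar>f x\<bar>) * indicator \<Omega> x \<partial>lebesgue)"
    by (rule nn_integral_restrict_space[OF \<Omega>s])
  also have "\<dots> \<le> (\<integral>\<^sup>+x. H (- \<sigma>) x + H \<sigma> x \<partial>lebesgue)"
  proof (rule nn_integral_mono)
    fix x
    show "ennreal L * ennreal (M x \<bar>f x\<bar>) * indicator \<Omega> x \<le> H (- \<sigma>) x + H \<sigma> x"
    proof (cases "x \<in> \<Omega>")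
      case True
      have "ennreal (M z (4 * L * \<bar>partial_deriv i f z\<bar>)) \<le> G z" if "z \<in> \<Omega>" for z
        using G(2)[of z] that by (simp add: g_def)
      from pointwise_bound[OF M Y f True L this] show ?thesis
        \<comment> \<open>The two summands of the pointwise bound are \<open>H (- \<sigma>)\<close>
          and \<open>H \<sigma>\<close>; each integrates to the same value, which is the origin of
          the factor 2 below.\<close>
        using True L(1) by (simp add: H_def ennreal_mult' phi_nonneg[OF M True])
    qed simp
  qed
  also have "\<dots> = (\<integral>\<^sup>+x. H (- \<sigma>) x + H \<sigma> x \<partial>lborel)" by (rule nn_integral_completion)
  also have "\<dots> = (\<integral>\<^sup>+x. H (- \<sigma>) x \<partial>lborel) + (\<integral>\<^sup>+x. H \<sigma> x \<partial>lborel)"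
    by (rule nn_integral_add[OF Hm Hm])
  also have "\<dots> = ennreal L * (2 * (\<integral>\<^sup>+x. g x \<partial>lebesgue))"
    unfolding HI G(3) by (metis distrib_left mult_2)
  finally have "modular \<Omega> M f \<le> 2 * (\<integral>\<^sup>+x. g x \<partial>lebesgue)"
    using L(1) by (simp add: ennreal_mult_le_mult_iff)
  also have "(\<integral>\<^sup>+x. g x \<partial>lebesgue) = (\<integral>\<^sup>+x. ennreal (M x (4 * L * \<bar>partial_deriv i f x\<bar>)) \<partial>lebesgue_on \<Omega>)"
    unfolding g_def by (rule nn_integral_restrict_space[OF \<Omega>s, symmetric])
  also have "2 * \<dots> = (\<integral>\<^sup>+x. 2 * ennreal (M x (4 * L * \<bar>partial_deriv i f x\<bar>)) \<partial>lebesgue_on \<Omega>)"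
    using phi_measurable_scaled[OF M test_measurable[OF test_partial_deriv[OF f]], of "4 * L" i] L(1)
    by (intro nn_integral_cmult[symmetric]) auto
  also have "\<dots> \<le> modular \<Omega> M (\<lambda>x. 8 * L * partial_deriv i f x)"
    unfolding modular_def
  proof (rule nn_integral_mono)
    fix x assume "x \<in> space (lebesgue_on \<Omega>)"
    then have x: "x \<in> \<Omega>" by (simp add: space_restrict_space)
    have "2 * M x (4 * L * \<bar>partial_deriv i f x\<bar>) \<le> M x (2 * (4 * L * \<bar>partial_deriv i f x\<bar>))"
      using L(1) by (intro phi_scale_le[OF M x]) auto
    also have "2 * (4 * L * \<bar>partial_deriv i f x\<bar>) = \<bar>8 * L * partial_deriv i f x\<bar>"
      using L(1) by (simp add: abs_mult)
    finally have "ennreal (2 * M x (4 * L * \<bar>partial_deriv i f x\<bar>)) \<le> ennreal (M x \<bar>8 * L * partial_deriv i f x\<bar>)"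
      by (rule ennreal_leI)
    then show "2 * ennreal (M x (4 * L * \<bar>partial_deriv i f x\<bar>)) \<le> ennreal (M x \<bar>8 * L * partial_deriv i f x\<bar>)"
      by (simp add: ennreal_mult')
  qed
  finally show ?thesis .
qed

text \<open>As the modular is not homogeneous, the scalar \<open>c\<close> belongs to the statement:
  each step applies the first-order inequality to the test function already multiplied by
  \<open>c * (8 * L) ^ k\<close>.\<close>

lemma modular_test_poincare_iterated:
  fixes f :: "real^'n \<Rightarrow> real"
  assumes M: "phi_function \<Omega> M" and Y: "Y_along \<Omega> i \<sigma> t0 M"
    and \<Omega>: "open \<Omega>" and f: "f \<in> test_functions \<Omega>"
    and L: "L > 0" "\<And>x y. x \<in> \<Omega> \<Longrightarrow> y \<in> \<Omega> \<Longrightarrow> dist x y < L"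
  shows "modular \<Omega> M (\<lambda>x. c * f x) \<le> modular \<Omega> M (\<lambda>x. c * (8 * L) ^ k * (partial_deriv i ^^ k) f x)"
proof (induction k)
  case (Suc k)
  let ?h = "(partial_deriv i ^^ k) f"
  have h: "?h \<in> test_functions \<Omega>" by (rule test_funpow[OF f])
  have "partial_deriv i (\<lambda>x. c * (8 * L) ^ k * ?h x) = (\<lambda>x. c * (8 * L) ^ k * partial_deriv i ?h x)"
    by (intro ext partial_deriv_cmult smooth_differentiable test_functions_smooth[OF h])
  then have "modular \<Omega> M (\<lambda>x. c * (8 * L) ^ k * ?h x)
      \<le> modular \<Omega> M (\<lambda>x. 8 * L * (c * (8 * L) ^ k * partial_deriv i ?h x))"
    using modular_test_poincare[OF M Y \<Omega> test_cmult[OF h] L, of "c * (8 * L) ^ k"] by simp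
  also have "(\<lambda>x. 8 * L * (c * (8 * L) ^ k * partial_deriv i ?h x)) =
      (\<lambda>x. c * (8 * L) ^ Suc k * (partial_deriv i ^^ Suc k) f x)"
    by (simp add: mult_ac)
  finally show ?case using Suc by (rule order_trans[rotated])
qed simp

section \<open>Extension to the closure of the test functions\<close>

lemma modular_cong_AE:
  "AE x in lebesgue_on \<Omega>. u x = v x \<Longrightarrow> modular \<Omega> M u = modular \<Omega> M v"
  unfolding modular_def by (intro nn_integral_cong_AE) (auto elim: AE_mp)

lemma modular_mono:
  assumes "phi_function \<Omega> M" "\<And>x. x \<in> \<Omega> \<Longrightarrow> \<bar>u x\<bar> \<le> \<bar>v x\<bar>"
  shows "modular \<Omega> M u \<le> modular \<Omega> M v"
  unfolding modular_def
  by (intro nn_integral_mono ennreal_leI phi_mono[OF assms(1)]) (auto simp: space_restrict_space assms(2))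

lemma modular_measurable:
  assumes "phi_function \<Omega> M" "u \<in> borel_measurable (lebesgue_on \<Omega>)"
  shows "(\<lambda>x. ennreal (M x \<bar>u x\<bar>)) \<in> borel_measurable (lebesgue_on \<Omega>)"
  using phi_measurable[OF assms] by (intro measurable_compose[OF _ measurable_ennreal])

lemma modular_scale_le:
  assumes "phi_function \<Omega> M" "u \<in> borel_measurable (lebesgue_on \<Omega>)" "0 \<le> c" "c \<le> 1"
  shows "modular \<Omega> M (\<lambda>x. c * u x) \<le> ennreal c * modular \<Omega> M u"
proof -
  have "modular \<Omega> M (\<lambda>x. c * u x) \<le> (\<integral>\<^sup>+x. ennreal c * ennreal (M x \<bar>u x\<bar>) \<partial>lebesgue_on \<Omega>)"
    unfolding modular_def
  proof (rule nn_integral_mono)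
    fix x assume "x \<in> space (lebesgue_on \<Omega>)"
    then have x: "x \<in> \<Omega>" by (simp add: space_restrict_space)
    have "M x (c * \<bar>u x\<bar>) \<le> c * M x \<bar>u x\<bar>"
      using assms(3,4) by (intro convex_le_scaled phi_convex[OF assms(1) x] phi_zero[OF assms(1) x]) auto
    then have "ennreal (M x \<bar>c * u x\<bar>) \<le> ennreal (c * M x \<bar>u x\<bar>)"
      using assms(3) by (intro ennreal_leI) (simp add: abs_mult)
    then show "ennreal (M x \<bar>c * u x\<bar>) \<le> ennreal c * ennreal (M x \<bar>u x\<bar>)"
      using assms(3) by (simp add: ennreal_mult')
  qed
  also have "\<dots> = ennreal c * modular \<Omega> M u"
    unfolding modular_def by (rule nn_integral_cmult[OF modular_measurable[OF assms(1,2)]])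
  finally show ?thesis .
qed

lemma modular_scale_ge:
  assumes "phi_function \<Omega> M" "u \<in> borel_measurable (lebesgue_on \<Omega>)" "1 \<le> c"
  shows "ennreal c * modular \<Omega> M u \<le> modular \<Omega> M (\<lambda>x. c * u x)"
proof -
  have "ennreal c * modular \<Omega> M u = ennreal c * modular \<Omega> M (\<lambda>x. 1 / c * (c * u x))"
    using assms(3) by simp
  also have "\<dots> \<le> ennreal c * (ennreal (1 / c) * modular \<Omega> M (\<lambda>x. c * u x))"
    using assms by (intro mult_left_mono modular_scale_le borel_measurable_times) auto
  also have "\<dots> = ennreal (c * (1 / c)) * modular \<Omega> M (\<lambda>x. c * u x)"
    using assms(3) by (subst ennreal_mult) (auto simp: mult.assoc)
  also have "\<dots> = modular \<Omega> M (\<lambda>x. c * u x)" using assms(3) by simp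
  finally show ?thesis .
qed

text \<open>The substitute for subadditivity, from convexity at the midpoint with the weights 1/2
  dropped. Each application doubles the arguments; two applications account for the factor 4 in the
  final constant.\<close>

lemma modular_add_le:
  assumes M: "phi_function \<Omega> M" and u: "u \<in> borel_measurable (lebesgue_on \<Omega>)"
    and v: "v \<in> borel_measurable (lebesgue_on \<Omega>)"
  shows "modular \<Omega> M (\<lambda>x. u x + v x) \<le> modular \<Omega> M (\<lambda>x. 2 * u x) + modular \<Omega> M (\<lambda>x. 2 * v x)"
proof -
  have m: "(\<lambda>x. 2 * u x) \<in> borel_measurable (lebesgue_on \<Omega>)" "(\<lambda>x. 2 * v x) \<in> borel_measurable (lebesgue_on \<Omega>)"
    by (rule borel_measurable_times[OF borel_measurable_const u])
      (rule borel_measurable_times[OF borel_measurable_const v])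
  have "modular \<Omega> M (\<lambda>x. u x + v x) \<le>
    (\<integral>\<^sup>+x. ennreal (M x \<bar>2 * u x\<bar>) + ennreal (M x \<bar>2 * v x\<bar>) \<partial>lebesgue_on \<Omega>)"
    unfolding modular_def
  proof (rule nn_integral_mono)
    fix x assume "x \<in> space (lebesgue_on \<Omega>)"
    then have x: "x \<in> \<Omega>" by (simp add: space_restrict_space)
    have nn: "M x \<bar>2 * u x\<bar> \<ge> 0" "M x \<bar>2 * v x\<bar> \<ge> 0" by (simp_all add: phi_nonneg[OF M x])
    have "M x \<bar>u x + v x\<bar> \<le> M x (\<bar>u x\<bar> + \<bar>v x\<bar>)" by (intro phi_mono[OF M x]) auto
    also have "\<dots> \<le> M x (2 * \<bar>u x\<bar>) / 2 + M x (2 * \<bar>v x\<bar>) / 2"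
      by (intro convex_halves phi_convex[OF M x]) auto
    also have "\<dots> \<le> M x \<bar>2 * u x\<bar> + M x \<bar>2 * v x\<bar>" using nn by (simp add: abs_mult)
    finally have "ennreal (M x \<bar>u x + v x\<bar>) \<le> ennreal (M x \<bar>2 * u x\<bar> + M x \<bar>2 * v x\<bar>)" by (rule ennreal_leI)
    then show "ennreal (M x \<bar>u x + v x\<bar>) \<le> ennreal (M x \<bar>2 * u x\<bar>) + ennreal (M x \<bar>2 * v x\<bar>)"
      by (simp only: ennreal_plus[OF nn])
  qed
  also have "\<dots> = modular \<Omega> M (\<lambda>x. 2 * u x) + modular \<Omega> M (\<lambda>x. 2 * v x)"
    unfolding modular_def by (intro nn_integral_add modular_measurable M m)
  finally show ?thesis .
qed

section \<open>The space E_M and approximation by test functions\<close>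

lemma
  assumes "u \<in> E_space \<Omega> M"
  shows E_space_measurable: "u \<in> borel_measurable (lebesgue_on \<Omega>)"
    and E_space_modular_finite: "c > 0 \<Longrightarrow> modular \<Omega> M (\<lambda>x. c * u x) < \<infinity>"
proof -
  show "u \<in> borel_measurable (lebesgue_on \<Omega>)" using assms by (simp add: E_space_def)
  assume "c > 0"
  then have "1 / c > 0" by simp
  then have "modular \<Omega> M (\<lambda>x. u x / (1 / c)) < \<infinity>" using assms unfolding E_space_def by blast
  then show "modular \<Omega> M (\<lambda>x. c * u x) < \<infinity>" by (simp add: mult.commute)
qed

lemma E_spaceI:
  assumes "u \<in> borel_measurable (lebesgue_on \<Omega>)" "\<And>c. c > 0 \<Longrightarrow> modular \<Omega> M (\<lambda>x. c * u x) < \<infinity>"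
  shows "u \<in> E_space \<Omega> M"
  unfolding E_space_def
proof (intro CollectI conjI allI impI assms(1))
  fix k :: real assume "k > 0"
  then show "modular \<Omega> M (\<lambda>x. u x / k) < \<infinity>" using assms(2)[of "1 / k"] by simp
qed

text \<open>Local integrability of \<open>M\<close> enters here: on the compact support the modular
  is dominated by the integral of \<open>M x (c * B)\<close>, where \<open>B\<close> bounds the
  function.\<close>

lemma test_in_E_space:
  assumes M: "phi_function \<Omega> M" "Phi_locally_integrable \<Omega> M" and \<Omega>: "open \<Omega>" and f: "f \<in> test_functions \<Omega>"
  shows "f \<in> E_space \<Omega> M"
proof (rule E_spaceI)
  show "f \<in> borel_measurable (lebesgue_on \<Omega>)" by (rule test_measurable[OF f])
  fix c :: real assume "c > 0"
  obtain K where K: "compact K" "K \<subseteq> \<Omega>" "\<And>x. x \<notin> K \<Longrightarrow> f x = 0"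
    using f by (rule test_functions_compactE) blast
  have "bounded (f ` K)"
    using K(1) smooth_continuous[OF test_functions_smooth[OF f]]
    by (intro compact_imp_bounded compact_continuous_image) (auto intro: continuous_on_subset)
  then obtain B where B: "B > 0" "\<And>x. x \<in> K \<Longrightarrow> \<bar>f x\<bar> \<le> B" unfolding bounded_pos by auto
  have Ks: "K \<inter> space lebesgue \<in> sets lebesgue" using K(1) by (simp add: compact_imp_closed)
  have \<Omega>s: "\<Omega> \<inter> space lebesgue \<in> sets lebesgue" using \<Omega> by auto
  have "locally_integrable \<Omega> (\<lambda>x. M x (c * B))"
    using M(2) \<open>c > 0\<close> B(1) by (simp add: Phi_locally_integrable_def)
  then have "integrable (lebesgue_on K) (\<lambda>x. M x (c * B))"
    using K by (simp add: locally_integrable_def)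
  then have fin: "(\<integral>\<^sup>+x. ennreal (norm (M x (c * B))) \<partial>lebesgue_on K) < \<infinity>"
    by (simp add: integrable_iff_bounded)
  have "modular \<Omega> M (\<lambda>x. c * f x) = (\<integral>\<^sup>+x. ennreal (M x \<bar>c * f x\<bar>) * indicator \<Omega> x \<partial>lebesgue)"
    unfolding modular_def by (rule nn_integral_restrict_space[OF \<Omega>s])
  also have "\<dots> \<le> (\<integral>\<^sup>+x. ennreal (norm (M x (c * B))) * indicator K x \<partial>lebesgue)"
  proof (rule nn_integral_mono)
    fix x
    show "ennreal (M x \<bar>c * f x\<bar>) * indicator \<Omega> x \<le> ennreal (norm (M x (c * B))) * indicator K x"
    proof (cases "x \<in> K")
      case True
      then have x: "x \<in> \<Omega>" using K(2) by auto
      have "M x \<bar>c * f x\<bar> \<le> M x (c * B)"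
        using B(2)[OF True] \<open>c > 0\<close> by (intro phi_mono[OF M(1) x]) (auto simp: abs_mult)
      then have "ennreal (M x \<bar>c * f x\<bar>) \<le> ennreal (norm (M x (c * B)))" by (intro ennreal_leI) auto
      then show ?thesis using True x by simp
    next
      case False
      then show ?thesis using K(3)[OF False] phi_zero[OF M(1), of x] by (auto simp: indicator_def)
    qed
  qed
  also have "\<dots> = (\<integral>\<^sup>+x. ennreal (norm (M x (c * B))) \<partial>lebesgue_on K)"
    by (rule nn_integral_restrict_space[OF Ks, symmetric])
  finally show "modular \<Omega> M (\<lambda>x. c * f x) < \<infinity>" using fin by (rule le_less_trans)
qed

lemma E_space_diff:
  assumes M: "phi_function \<Omega> M" and u: "u \<in> E_space \<Omega> M" and v: "v \<in> E_space \<Omega> M"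
  shows "(\<lambda>x. u x - v x) \<in> E_space \<Omega> M"
proof (rule E_spaceI)
  note um = E_space_measurable[OF u] and vm = E_space_measurable[OF v]
  show "(\<lambda>x. u x - v x) \<in> borel_measurable (lebesgue_on \<Omega>)" by (rule borel_measurable_diff[OF um vm])
  fix c :: real assume c: "c > 0"
  have "modular \<Omega> M (\<lambda>x. c * (u x - v x)) = modular \<Omega> M (\<lambda>x. c * u x + (- c) * v x)"
    by (simp add: algebra_simps)
  also have "\<dots> \<le> modular \<Omega> M (\<lambda>x. 2 * (c * u x)) + modular \<Omega> M (\<lambda>x. 2 * ((- c) * v x))"
    by (intro modular_add_le M borel_measurable_times um vm) auto
  also have "\<dots> \<le> modular \<Omega> M (\<lambda>x. (2 * c) * u x) + modular \<Omega> M (\<lambda>x. (2 * c) * v x)"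
    by (intro add_mono modular_mono M) (auto simp: abs_mult)
  also have "\<dots> < \<infinity>"
    using E_space_modular_finite[OF u, of "2 * c"] E_space_modular_finite[OF v, of "2 * c"] c by simp
  finally show "modular \<Omega> M (\<lambda>x. c * (u x - v x)) < \<infinity>" .
qed

text \<open>If the norm of the difference lies below \<open>\<delta>\<close>, some
  \<open>k < \<delta>\<close> makes the modular of \<open>W \<alpha> / k\<close> at most 1. Writing
  \<open>A * W \<alpha>\<close> as \<open>A * k\<close> times this quotient, convexity bounds its
  modular by \<open>A * k\<close>.\<close>

lemma WE0_approximation:
  fixes \<Omega> :: "(real^'n) set"
  assumes M: "phi_function \<Omega> M" "Phi_locally_integrable \<Omega> M" and \<Omega>: "open \<Omega>"
    and u: "u \<in> WE0_space m \<Omega> M"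
    and V: "\<And>\<alpha>. mi_order \<alpha> \<le> m \<Longrightarrow> V \<alpha> \<in> E_space \<Omega> M" "\<And>\<alpha>. mi_order \<alpha> \<le> m \<Longrightarrow> is_weak_deriv \<Omega> \<alpha> u (V \<alpha>)"
    and A: "A > 0" and \<epsilon>: "\<epsilon> > 0"
  obtains \<phi> where "\<phi> \<in> test_functions \<Omega>"
    "\<And>\<alpha>. mi_order \<alpha> \<le> m \<Longrightarrow> modular \<Omega> M (\<lambda>x. A * (V \<alpha> x - classical_deriv \<alpha> \<phi> x)) \<le> ennreal \<epsilon>"
proof -
  \<comment> \<open>\<open>A * \<delta> \<le> 1\<close> makes the convexity estimate applicable,
    \<open>A * \<delta> \<le> \<epsilon>\<close> makes its result small.\<close>
  define \<delta> where "\<delta> = min (1 / A) (\<epsilon> / A)"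
  have \<delta>: "\<delta> > 0" "A * \<delta> \<le> 1" "A * \<delta> \<le> \<epsilon>" using A \<epsilon> by (auto simp: \<delta>_def min_def field_simps)
  obtain \<phi> where \<phi>: "\<phi> \<in> test_functions \<Omega>" "sobolev_norm m \<Omega> M (\<lambda>x. u x - \<phi> x) < \<delta>"
    using u \<delta>(1) unfolding WE0_space_def by blast
  define W where "W \<alpha> x = V \<alpha> x - classical_deriv \<alpha> \<phi> x" for \<alpha> x
  let ?I = "{\<alpha> :: 'n \<Rightarrow> nat. mi_order \<alpha> \<le> m}"
  have WE: "W \<alpha> \<in> E_space \<Omega> M" if "\<alpha> \<in> ?I" for \<alpha>
    unfolding W_def using that
    by (intro E_space_diff M V test_in_E_space \<Omega> test_classical_deriv \<phi>) auto
  note Wm = E_space_measurable[OF WE]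
  have AE: "AE x in lebesgue_on \<Omega>. weak_deriv \<Omega> \<alpha> (\<lambda>x. u x - \<phi> x) x = W \<alpha> x" if "\<alpha> \<in> ?I" for \<alpha>
    unfolding W_def using that
    by (intro weak_deriv_AE is_weak_deriv_diff \<Omega> V test_is_weak_deriv \<phi>) auto
  have mod_eq: "modular \<Omega> M (\<lambda>x. weak_deriv \<Omega> \<alpha> (\<lambda>x. u x - \<phi> x) x / k) = modular \<Omega> M (\<lambda>x. W \<alpha> x / k)"
    if "\<alpha> \<in> ?I" for \<alpha> k
    by (rule modular_cong_AE) (use AE[OF that] in \<open>auto elim: AE_mp\<close>)
  let ?S = "{k. k > 0 \<and> (\<Sum>\<alpha>\<in>?I. modular \<Omega> M (\<lambda>x. W \<alpha> x / k)) \<le> 1}"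
  have norm_eq: "sobolev_norm m \<Omega> M (\<lambda>x. u x - \<phi> x) = Inf ?S"
    unfolding sobolev_norm_def by (simp add: mod_eq)
  \<comment> \<open>The infimum of the empty set carries no information, so an admissible
    \<open>k\<close> must exist before one below \<open>\<delta>\<close> can be extracted. Dividing
    by \<open>max 1 r\<close>, with \<open>r\<close> the finite total modular, provides it.\<close>
  have "?S \<noteq> {}"
  proof -
    have "(\<Sum>\<alpha>\<in>?I. modular \<Omega> M (W \<alpha>)) < \<infinity>"
      using E_space_modular_finite[OF WE, of _ 1] by (auto simp: finite_mi_order_le)
    then obtain r where r: "r \<ge> 0" "(\<Sum>\<alpha>\<in>?I. modular \<Omega> M (W \<alpha>)) = ennreal r"
      by (cases "\<Sum>\<alpha>\<in>?I. modular \<Omega> M (W \<alpha>)" rule: ennreal_cases) auto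
    define k where "k = max 1 r"
    have k: "k \<ge> 1" "k \<ge> r" by (auto simp: k_def)
    have "(\<Sum>\<alpha>\<in>?I. modular \<Omega> M (\<lambda>x. W \<alpha> x / k)) = (\<Sum>\<alpha>\<in>?I. modular \<Omega> M (\<lambda>x. (1 / k) * W \<alpha> x))" by simp
    also have "\<dots> \<le> (\<Sum>\<alpha>\<in>?I. ennreal (1 / k) * modular \<Omega> M (W \<alpha>))"
      using k by (intro sum_mono modular_scale_le M Wm) auto
    also have "\<dots> = ennreal (1 / k) * ennreal r" by (simp add: r(2) flip: sum_distrib_left)
    also have "\<dots> = ennreal (1 / k * r)" using k r by (intro ennreal_mult[symmetric]) auto
    also have "\<dots> \<le> 1" using k r by (auto simp: ennreal_le_1)
    finally have "k \<in> ?S" using k by simp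
    then show ?thesis by blast
  qed
  from cInf_lessD[OF this \<phi>(2)[unfolded norm_eq]] obtain k
    where k: "k > 0" "(\<Sum>\<alpha>\<in>?I. modular \<Omega> M (\<lambda>x. W \<alpha> x / k)) \<le> 1" "k < \<delta>" by blast
  have "modular \<Omega> M (\<lambda>x. A * W \<alpha> x) \<le> ennreal \<epsilon>" if \<alpha>: "\<alpha> \<in> ?I" for \<alpha>
  proof -
    have "A * k \<le> A * \<delta>" using A k(3) by simp
    then have Ak: "A * k \<le> 1" "A * k \<le> \<epsilon>" using \<delta>(2,3) by linarith+
    have Ak0: "0 \<le> A * k" using A k(1) by simp
    have "modular \<Omega> M (\<lambda>x. W \<alpha> x / k) \<le> (\<Sum>\<alpha>\<in>?I. modular \<Omega> M (\<lambda>x. W \<alpha> x / k))"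
      using \<alpha> by (intro member_le_sum) (auto simp: finite_mi_order_le)
    with k(2) have one: "modular \<Omega> M (\<lambda>x. W \<alpha> x / k) \<le> 1" by (rule order_trans[rotated])
    have "modular \<Omega> M (\<lambda>x. A * W \<alpha> x) = modular \<Omega> M (\<lambda>x. (A * k) * (W \<alpha> x / k))" using k(1) by simp
    also have "\<dots> \<le> ennreal (A * k) * modular \<Omega> M (\<lambda>x. W \<alpha> x / k)"
      using Ak Ak0 by (intro modular_scale_le M borel_measurable_divide Wm \<alpha>) auto
    also have "\<dots> \<le> ennreal (A * k) * 1" by (intro mult_left_mono one) auto
    also have "\<dots> \<le> ennreal \<epsilon>" using Ak by (simp add: ennreal_leI)
    finally show ?thesis .
  qed
  then show ?thesis using that[OF \<phi>(1)] unfolding W_def by simp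
qed

lemma modular_poincare:
  fixes \<Omega> :: "(real^'n) set"
  assumes M: "phi_function \<Omega> M" "Phi_locally_integrable \<Omega> M" and Y: "Y_along \<Omega> i \<sigma> t0 M" and \<Omega>: "open \<Omega>"
    and L: "L \<ge> 1" "\<And>x y. x \<in> \<Omega> \<Longrightarrow> y \<in> \<Omega> \<Longrightarrow> dist x y < L"
    and u: "u \<in> WE0_space m \<Omega> M"
    and V: "\<And>\<alpha>. mi_order \<alpha> \<le> m \<Longrightarrow> V \<alpha> \<in> E_space \<Omega> M" "\<And>\<alpha>. mi_order \<alpha> \<le> m \<Longrightarrow> is_weak_deriv \<Omega> \<alpha> u (V \<alpha>)"
    and \<alpha>: "mi_order \<alpha> + k = m" and c: "c \<ge> 0"
  shows "modular \<Omega> M (\<lambda>x. c * V \<alpha> x) \<le> modular \<Omega> M (\<lambda>x. c * (4 * (8 * L) ^ m) * V (\<alpha>(i := \<alpha> i + k)) x)"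
proof (rule ennreal_le_epsilon)
  fix e :: real assume "e > 0"
  define C where "C = (8 * L) ^ m"
  \<comment> \<open>Since \<open>L \<ge> 1\<close>, the exponent may be raised from \<open>k\<close>
    to \<open>m\<close>, which makes the constant the same for all \<open>\<alpha>\<close>.\<close>
  have "(8 * L) ^ k \<le> C" unfolding C_def using L(1) \<alpha> by (intro power_increasing) auto
  moreover have "1 \<le> (8 * L) ^ k" using L(1) by (intro one_le_power) auto
  ultimately have C: "(8 * L) ^ k \<le> C" "1 \<le> C" "0 \<le> (8 * L) ^ k" by auto
  \<comment> \<open>Large enough for both multiples of the error that occur, \<open>2 * c\<close> at
    \<open>\<alpha>\<close> and \<open>4 * c * C\<close> at \<open>\<beta>\<close>; the summand 1
    covers \<open>c = 0\<close>.\<close>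
  define A where "A = 4 * c * C + 1"
  have cC: "c \<le> c * C" using c C(2) mult_left_mono[of 1 C c] by simp
  have A: "A > 0" "2 * c \<le> A" "4 * c * C \<le> A" using c cC by (auto simp: A_def add_nonneg_pos)
  define \<beta> where "\<beta> = \<alpha>(i := \<alpha> i + k)"
  have ord: "mi_order \<alpha> \<le> m" "mi_order \<beta> \<le> m" using \<alpha> by (auto simp: \<beta>_def mi_order_upd)
  obtain \<phi> where \<phi>: "\<phi> \<in> test_functions \<Omega>"
    "\<And>\<alpha>. mi_order \<alpha> \<le> m \<Longrightarrow> modular \<Omega> M (\<lambda>x. A * (V \<alpha> x - classical_deriv \<alpha> \<phi> x)) \<le> ennreal (e / 2)"
    using WE0_approximation[OF M \<Omega> u V A(1), of "e / 2"] \<open>e > 0\<close> by auto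
  let ?D = "\<lambda>\<alpha>. classical_deriv \<alpha> \<phi>"
  let ?W = "\<lambda>\<alpha> x. V \<alpha> x - ?D \<alpha> x"
  have D: "?D \<gamma> \<in> test_functions \<Omega>" for \<gamma> by (rule test_classical_deriv[OF \<phi>(1)])
  have Dm: "?D \<gamma> \<in> borel_measurable (lebesgue_on \<Omega>)" for \<gamma> by (rule test_measurable[OF D])
  have Vm: "V \<gamma> \<in> borel_measurable (lebesgue_on \<Omega>)" if "mi_order \<gamma> \<le> m" for \<gamma>
    by (rule E_space_measurable[OF V(1)[OF that]])
  have small: "modular \<Omega> M (\<lambda>x. b * ?W \<gamma> x) \<le> ennreal (e / 2)" if "mi_order \<gamma> \<le> m" "\<bar>b\<bar> \<le> A" for b \<gamma>
  proof -
    have "modular \<Omega> M (\<lambda>x. b * ?W \<gamma> x) \<le> modular \<Omega> M (\<lambda>x. A * ?W \<gamma> x)"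
      using that(2) A(1) by (intro modular_mono[OF M(1)]) (auto simp: abs_mult intro!: mult_right_mono)
    also have "\<dots> \<le> ennreal (e / 2)" by (rule \<phi>(2)[OF that(1)])
    finally show ?thesis .
  qed
  have "modular \<Omega> M (\<lambda>x. c * V \<alpha> x) = modular \<Omega> M (\<lambda>x. c * ?D \<alpha> x + c * ?W \<alpha> x)"
    by (simp add: algebra_simps)
  also have "\<dots> \<le> modular \<Omega> M (\<lambda>x. 2 * (c * ?D \<alpha> x)) + modular \<Omega> M (\<lambda>x. 2 * (c * ?W \<alpha> x))"
    by (intro modular_add_le M borel_measurable_times borel_measurable_diff Dm Vm ord) auto
  also have "\<dots> = modular \<Omega> M (\<lambda>x. (2 * c) * ?D \<alpha> x) + modular \<Omega> M (\<lambda>x. (2 * c) * ?W \<alpha> x)"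
    by (simp only: mult.assoc)
  also have "\<dots> \<le> modular \<Omega> M (\<lambda>x. 2 * c * (8 * L) ^ k * ?D \<beta> x) + ennreal (e / 2)"
  proof (rule add_mono)
    show "modular \<Omega> M (\<lambda>x. (2 * c) * ?W \<alpha> x) \<le> ennreal (e / 2)"
      using A c by (intro small ord) auto
    show "modular \<Omega> M (\<lambda>x. (2 * c) * ?D \<alpha> x) \<le> modular \<Omega> M (\<lambda>x. 2 * c * (8 * L) ^ k * ?D \<beta> x)"
      using modular_test_poincare_iterated[OF M(1) Y \<Omega> D _ L(2), of "2 * c" \<alpha> k] L(1)
      by (simp add: funpow_partial_deriv_classical_deriv[OF test_functions_smooth[OF \<phi>(1)]] \<beta>_def)
  qed
  also have "modular \<Omega> M (\<lambda>x. 2 * c * (8 * L) ^ k * ?D \<beta> x) \<le> modular \<Omega> M (\<lambda>x. 2 * c * C * ?D \<beta> x)"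
  proof (rule modular_mono[OF M(1)])
    fix x
    have "0 \<le> 2 * c * (8 * L) ^ k" "2 * c * (8 * L) ^ k \<le> 2 * c * C"
      using C c by (auto intro: mult_left_mono simp del: power_mult_distrib)
    then have "\<bar>2 * c * (8 * L) ^ k\<bar> * \<bar>?D \<beta> x\<bar> \<le> \<bar>2 * c * C\<bar> * \<bar>?D \<beta> x\<bar>"
      by (intro mult_right_mono) auto
    then show "\<bar>2 * c * (8 * L) ^ k * ?D \<beta> x\<bar> \<le> \<bar>2 * c * C * ?D \<beta> x\<bar>"
      by (simp only: abs_mult)
  qed
  \<comment> \<open>The return from the test function to \<open>u\<close> at the top order, at the
    price of the second doubling.\<close>
  also have "\<dots> = modular \<Omega> M (\<lambda>x. 2 * c * C * V \<beta> x + - (2 * c * C) * ?W \<beta> x)"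
    by (simp add: algebra_simps)
  also have "\<dots> \<le> modular \<Omega> M (\<lambda>x. 2 * (2 * c * C * V \<beta> x)) + modular \<Omega> M (\<lambda>x. 2 * (- (2 * c * C) * ?W \<beta> x))"
    by (intro modular_add_le M borel_measurable_times borel_measurable_diff Dm Vm ord) auto
  also have "\<dots> = modular \<Omega> M (\<lambda>x. c * (4 * C) * V \<beta> x) + modular \<Omega> M (\<lambda>x. - (4 * c * C) * ?W \<beta> x)"
    by (simp add: mult_ac)
  also have "modular \<Omega> M (\<lambda>x. - (4 * c * C) * ?W \<beta> x) \<le> ennreal (e / 2)"
    using A c C by (intro small ord) auto
  finally have "modular \<Omega> M (\<lambda>x. c * V \<alpha> x) \<le>
      modular \<Omega> M (\<lambda>x. c * (4 * C) * V \<beta> x) + ennreal (e / 2) + ennreal (e / 2)"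
    by (simp add: add_mono)
  also have "\<dots> = modular \<Omega> M (\<lambda>x. c * (4 * C) * V \<beta> x) + ennreal e"
    using \<open>e > 0\<close> by (simp add: add.assoc flip: ennreal_plus)
  finally show "modular \<Omega> M (\<lambda>x. c * V \<alpha> x) \<le>
      modular \<Omega> M (\<lambda>x. c * (4 * (8 * L) ^ m) * V (\<alpha>(i := \<alpha> i + k)) x) + ennreal e"
    by (simp add: C_def \<beta>_def)
qed

section \<open>From modular inequalities to Luxemburg norms\<close>

lemma luxemburg_norm_cong_AE:
  assumes "AE x in lebesgue_on \<Omega>. u x = v x"
  shows "luxemburg_norm \<Omega> M u = luxemburg_norm \<Omega> M v"
proof -
  have "modular \<Omega> M (\<lambda>x. u x / k) = modular \<Omega> M (\<lambda>x. v x / k)" for k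
    by (rule modular_cong_AE) (use assms in \<open>auto elim: AE_mp\<close>)
  then show ?thesis by (simp add: luxemburg_norm_def)
qed

lemma luxemburg_set_nonempty:
  assumes M: "phi_function \<Omega> M" and v: "v \<in> E_space \<Omega> M"
  shows "{k. k > 0 \<and> modular \<Omega> M (\<lambda>x. v x / k) \<le> 1} \<noteq> {}"
proof -
  obtain r where r: "r \<ge> 0" "modular \<Omega> M v = ennreal r"
    using E_space_modular_finite[OF v, of 1] by (cases "modular \<Omega> M v" rule: ennreal_cases) auto
  define k where "k = max 1 r"
  have k: "k \<ge> 1" "k \<ge> r" by (auto simp: k_def)
  have "modular \<Omega> M (\<lambda>x. v x / k) = modular \<Omega> M (\<lambda>x. (1 / k) * v x)" by simp
  also have "\<dots> \<le> ennreal (1 / k) * modular \<Omega> M v"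
    using k by (intro modular_scale_le M E_space_measurable[OF v]) auto
  also have "\<dots> = ennreal (1 / k * r)" unfolding r(2) using k r by (intro ennreal_mult[symmetric]) auto
  also have "\<dots> \<le> 1" using k r by (auto simp: ennreal_le_1)
  finally have "k \<in> {k. k > 0 \<and> modular \<Omega> M (\<lambda>x. v x / k) \<le> 1}" using k by simp
  then show ?thesis by blast
qed

lemma luxemburg_norm_nonneg:
  assumes "phi_function \<Omega> M" "v \<in> E_space \<Omega> M"
  shows "luxemburg_norm \<Omega> M v \<ge> 0"
  unfolding luxemburg_norm_def by (rule cInf_greatest[OF luxemburg_set_nonempty[OF assms]]) auto

text \<open>For every \<open>k\<close> admissible in the norm of \<open>v\<close>, the number
  \<open>C * k\<close> is admissible for \<open>w\<close>, by the hypothesis at scale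
  \<open>1 / (C * k)\<close>. This is why the modular inequality is needed for all scalars.\<close>

lemma luxemburg_norm_le:
  assumes M: "phi_function \<Omega> M" and v: "v \<in> E_space \<Omega> M" and C: "C > 0"
    and le: "\<And>c. c > 0 \<Longrightarrow> modular \<Omega> M (\<lambda>x. c * w x) \<le> modular \<Omega> M (\<lambda>x. c * C * v x)"
  shows "luxemburg_norm \<Omega> M w \<le> C * luxemburg_norm \<Omega> M v"
proof -
  have "luxemburg_norm \<Omega> M w / C \<le> luxemburg_norm \<Omega> M v"
    unfolding luxemburg_norm_def[of _ _ v]
  proof (rule cInf_greatest[OF luxemburg_set_nonempty[OF M v]])
    fix k assume "k \<in> {k. k > 0 \<and> modular \<Omega> M (\<lambda>x. v x / k) \<le> 1}"
    then have k: "k > 0" "modular \<Omega> M (\<lambda>x. v x / k) \<le> 1" by auto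
    have "modular \<Omega> M (\<lambda>x. w x / (C * k)) \<le> modular \<Omega> M (\<lambda>x. v x / k)"
      using le[of "1 / (C * k)"] C k(1) by simp
    then have "C * k \<in> {k. k > 0 \<and> modular \<Omega> M (\<lambda>x. w x / k) \<le> 1}"
      using C k by (auto intro: order_trans)
    then have "luxemburg_norm \<Omega> M w \<le> C * k"
      unfolding luxemburg_norm_def by (rule cInf_lower) (auto intro: bdd_belowI[of _ 0])
    then show "luxemburg_norm \<Omega> M w / C \<le> k" using C by (simp add: divide_le_eq mult.commute)
  qed
  then show ?thesis using C by (simp add: divide_le_eq mult.commute)
qed

text \<open>The weak derivatives are handled through representatives \<open>V\<close> in \<^const>\<open>E_space\<close>, which
  \<^const>\<open>weak_deriv\<close> equals almost everywhere.\<close>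

lemma WE0_representatives:
  fixes \<Omega> :: "(real^'n) set"
  assumes M: "Phi_function \<Omega> M" "Phi_locally_integrable \<Omega> M" "Y_condition \<Omega> M" and \<Omega>: "open \<Omega>"
    and L: "L \<ge> 1" "\<And>x y. x \<in> \<Omega> \<Longrightarrow> y \<in> \<Omega> \<Longrightarrow> dist x y < L"
    and u: "u \<in> WE0_space m \<Omega> M"
  obtains V \<beta> where "\<And>\<alpha>. mi_order \<alpha> \<le> m \<Longrightarrow> V \<alpha> \<in> E_space \<Omega> M"
    "\<And>\<alpha>. mi_order \<alpha> \<le> m \<Longrightarrow> AE x in lebesgue_on \<Omega>. weak_deriv \<Omega> \<alpha> u x = V \<alpha> x"
    "\<And>\<alpha>. mi_order \<alpha> \<le> m \<Longrightarrow> mi_order (\<beta> \<alpha>) = m"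
    "\<And>\<alpha> c. mi_order \<alpha> \<le> m \<Longrightarrow> c \<ge> 0 \<Longrightarrow>
      modular \<Omega> M (\<lambda>x. c * V \<alpha> x) \<le> modular \<Omega> M (\<lambda>x. c * (4 * (8 * L) ^ m) * V (\<beta> \<alpha>) x)"
proof -
  have phi: "phi_function \<Omega> M" using M(1) by (simp add: Phi_function_def)
  obtain i \<sigma> t0 where Y: "Y_along \<Omega> i \<sigma> t0 M" using Y_condition_along[OF M(3)] .
  have "\<forall>\<alpha>. \<exists>v. mi_order \<alpha> \<le> m \<longrightarrow> v \<in> E_space \<Omega> M \<and> is_weak_deriv \<Omega> \<alpha> u v"
    using u unfolding WE0_space_def WE_space_def by blast
  then obtain V where V: "\<And>\<alpha>. mi_order \<alpha> \<le> m \<Longrightarrow> V \<alpha> \<in> E_space \<Omega> M"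
    "\<And>\<alpha>. mi_order \<alpha> \<le> m \<Longrightarrow> is_weak_deriv \<Omega> \<alpha> u (V \<alpha>)" by metis
  \<comment> \<open>The whole missing order goes into the coordinate of the Y-condition, the only
    direction in which the iteration works.\<close>
  define \<beta> where "\<beta> \<alpha> = \<alpha>(i := \<alpha> i + (m - mi_order \<alpha>))" for \<alpha>
  show ?thesis
  proof (rule that[of V \<beta>])
    fix \<alpha> :: "'n \<Rightarrow> nat" and c :: real assume \<alpha>: "mi_order \<alpha> \<le> m"
    show "V \<alpha> \<in> E_space \<Omega> M" by (rule V(1)[OF \<alpha>])
    show "AE x in lebesgue_on \<Omega>. weak_deriv \<Omega> \<alpha> u x = V \<alpha> x" by (rule weak_deriv_AE[OF \<Omega> V(2)[OF \<alpha>]])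
    show "mi_order (\<beta> \<alpha>) = m" using \<alpha> unfolding \<beta>_def mi_order_upd by simp
    assume "c \<ge> 0"
    then show "modular \<Omega> M (\<lambda>x. c * V \<alpha> x) \<le> modular \<Omega> M (\<lambda>x. c * (4 * (8 * L) ^ m) * V (\<beta> \<alpha>) x)"
      using modular_poincare[OF phi M(2) Y \<Omega> L u V, of \<alpha> "m - mi_order \<alpha>" c] \<alpha> by (simp add: \<beta>_def)
  qed
qed

text \<open>Exchanges sum and integral; the measurability needed for this is taken from the
  representatives \<open>V \<alpha>\<close>.\<close>

lemma nn_integral_sum_modular:
  fixes w :: "'b \<Rightarrow> real^'n \<Rightarrow> real"
  assumes M: "phi_function \<Omega> M" and I: "finite I" and c: "c \<ge> 0"
    and V: "\<And>\<alpha>. \<alpha> \<in> I \<Longrightarrow> V \<alpha> \<in> E_space \<Omega> M"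
      "\<And>\<alpha>. \<alpha> \<in> I \<Longrightarrow> AE x in lebesgue_on \<Omega>. w \<alpha> x = V \<alpha> x"
  shows "(\<integral>\<^sup>+x. ennreal (\<Sum>\<alpha>\<in>I. M x (c * \<bar>w \<alpha> x\<bar>)) \<partial>lebesgue_on \<Omega>) = (\<Sum>\<alpha>\<in>I. modular \<Omega> M (\<lambda>x. c * V \<alpha> x))"
proof -
  have "AE x in lebesgue_on \<Omega>. \<forall>\<alpha>\<in>I. w \<alpha> x = V \<alpha> x"
    using V(2) I by (simp add: AE_ball_countable countable_finite)
  then have "(\<integral>\<^sup>+x. ennreal (\<Sum>\<alpha>\<in>I. M x (c * \<bar>w \<alpha> x\<bar>)) \<partial>lebesgue_on \<Omega>)
      = (\<integral>\<^sup>+x. (\<Sum>\<alpha>\<in>I. ennreal (M x \<bar>c * V \<alpha> x\<bar>)) \<partial>lebesgue_on \<Omega>)"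
  proof (intro nn_integral_cong_AE, elim AE_mp, intro AE_I2 impI)
    fix x assume x: "x \<in> space (lebesgue_on \<Omega>)" and eq: "\<forall>\<alpha>\<in>I. w \<alpha> x = V \<alpha> x"
    then have "x \<in> \<Omega>" by (simp add: space_restrict_space)
    have "(\<Sum>\<alpha>\<in>I. M x (c * \<bar>w \<alpha> x\<bar>)) = (\<Sum>\<alpha>\<in>I. M x \<bar>c * V \<alpha> x\<bar>)"
      using eq c by (intro sum.cong) (auto simp: abs_mult)
    then show "ennreal (\<Sum>\<alpha>\<in>I. M x (c * \<bar>w \<alpha> x\<bar>)) = (\<Sum>\<alpha>\<in>I. ennreal (M x \<bar>c * V \<alpha> x\<bar>))"
      by (simp add: sum_ennreal phi_nonneg[OF M \<open>x \<in> \<Omega>\<close>])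
  qed
  also have "\<dots> = (\<Sum>\<alpha>\<in>I. modular \<Omega> M (\<lambda>x. c * V \<alpha> x))"
    unfolding modular_def
    by (intro nn_integral_sum modular_measurable M borel_measurable_times borel_measurable_const
        E_space_measurable[OF V(1)])
  finally show ?thesis .
qed

theorem theorem1p2:
  fixes \<Omega> :: "(real^'n) set" and m :: nat
  assumes "m \<ge> 1" and "open \<Omega>" and "bounded \<Omega>"
  shows "(\<exists>c>0. \<forall>M. Phi_function \<Omega> M \<and> Phi_locally_integrable \<Omega> M \<and> Y_condition \<Omega> M \<longrightarrow>
            (\<forall>u\<in>WE0_space m \<Omega> M.
               (\<integral>\<^sup>+x. ennreal (\<Sum>\<alpha> | mi_order \<alpha> < m. M x \<bar>weak_deriv \<Omega> \<alpha> u x\<bar>) \<partial>lebesgue_on \<Omega>)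
               \<le> (\<integral>\<^sup>+x. ennreal (\<Sum>\<alpha> | mi_order \<alpha> = m. M x (c * \<bar>weak_deriv \<Omega> \<alpha> u x\<bar>)) \<partial>lebesgue_on \<Omega>)))
       \<and> (\<exists>C. \<forall>M. Phi_function \<Omega> M \<and> Phi_locally_integrable \<Omega> M \<and> Y_condition \<Omega> M \<longrightarrow>
            (\<forall>u\<in>WE0_space m \<Omega> M.
               (\<Sum>\<alpha> | mi_order \<alpha> < m. luxemburg_norm \<Omega> M (weak_deriv \<Omega> \<alpha> u))
               \<le> C * (\<Sum>\<alpha> | mi_order \<alpha> = m. luxemburg_norm \<Omega> M (weak_deriv \<Omega> \<alpha> u))))"
proof -
  obtain B where B: "\<And>x y. x \<in> \<Omega> \<Longrightarrow> y \<in> \<Omega> \<Longrightarrow> dist x y \<le> B"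
    using \<open>bounded \<Omega>\<close> bounded_two_points by metis
  \<comment> \<open>\<open>B + 1\<close> turns the diameter bound into a strict one, and the maximum
    with 1 makes powers of \<open>8 * L\<close> increase with the exponent.\<close>
  define L where "L = max 1 (B + 1)"
  have L: "L \<ge> 1" "\<And>x y. x \<in> \<Omega> \<Longrightarrow> y \<in> \<Omega> \<Longrightarrow> dist x y < L"
    using B by (force simp: L_def less_max_iff_disj)+
  define c where "c = 4 * (8 * L) ^ m"
  have c: "c > 0" using L(1) by (simp add: c_def)
  let ?I = "{\<alpha> :: 'n \<Rightarrow> nat. mi_order \<alpha> < m}" and ?J = "{\<alpha> :: 'n \<Rightarrow> nat. mi_order \<alpha> = m}"
  have fin: "finite ?I" "finite ?J"
    by (rule finite_subset[OF _ finite_mi_order_le[of m]]; auto)+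
  \<comment> \<open>Each lower-order term is bounded crudely by the sum over all top-order ones, so
    this sum occurs \<open>N\<close> times. In the modular inequality convexity moves
    \<open>N\<close> into the argument of \<open>M\<close>, which uses \<open>N \<ge> 1\<close>; in
    the norm inequality it remains a factor.\<close>
  define N where "N = card ?I"
  have "(\<lambda>_. 0) \<in> ?I" using \<open>m \<ge> 1\<close> by (simp add: mi_order_def)
  then have N: "N \<ge> 1" using fin by (auto simp: N_def Suc_le_eq card_gt_0_iff)
  have first: "(\<integral>\<^sup>+x. ennreal (\<Sum>\<alpha>\<in>?I. M x \<bar>weak_deriv \<Omega> \<alpha> u x\<bar>) \<partial>lebesgue_on \<Omega>)
      \<le> (\<integral>\<^sup>+x. ennreal (\<Sum>\<alpha>\<in>?J. M x (real N * c * \<bar>weak_deriv \<Omega> \<alpha> u x\<bar>)) \<partial>lebesgue_on \<Omega>)"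
    and second: "(\<Sum>\<alpha>\<in>?I. luxemburg_norm \<Omega> M (weak_deriv \<Omega> \<alpha> u))
      \<le> real N * c * (\<Sum>\<alpha>\<in>?J. luxemburg_norm \<Omega> M (weak_deriv \<Omega> \<alpha> u))"
    if M: "Phi_function \<Omega> M" "Phi_locally_integrable \<Omega> M" "Y_condition \<Omega> M"
      and u: "u \<in> WE0_space m \<Omega> M" for M u
  proof -
    have phi: "phi_function \<Omega> M" using M(1) by (simp add: Phi_function_def)
    obtain V \<beta> where V: "\<And>\<alpha>. mi_order \<alpha> \<le> m \<Longrightarrow> V \<alpha> \<in> E_space \<Omega> M"
      "\<And>\<alpha>. mi_order \<alpha> \<le> m \<Longrightarrow> AE x in lebesgue_on \<Omega>. weak_deriv \<Omega> \<alpha> u x = V \<alpha> x"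
      and \<beta>: "\<And>\<alpha>. mi_order \<alpha> \<le> m \<Longrightarrow> mi_order (\<beta> \<alpha>) = m"
      and le: "\<And>\<alpha> b. mi_order \<alpha> \<le> m \<Longrightarrow> b \<ge> 0 \<Longrightarrow>
        modular \<Omega> M (\<lambda>x. b * V \<alpha> x) \<le> modular \<Omega> M (\<lambda>x. b * c * V (\<beta> \<alpha>) x)"
      unfolding c_def using WE0_representatives[OF M \<open>open \<Omega>\<close> L u] by blast
    have "(\<integral>\<^sup>+x. ennreal (\<Sum>\<alpha>\<in>?I. M x (1 * \<bar>weak_deriv \<Omega> \<alpha> u x\<bar>)) \<partial>lebesgue_on \<Omega>)
        = (\<Sum>\<alpha>\<in>?I. modular \<Omega> M (\<lambda>x. 1 * V \<alpha> x))"
      by (intro nn_integral_sum_modular phi fin V) auto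
    also have "\<dots> \<le> (\<Sum>\<alpha>\<in>?I. \<Sum>\<gamma>\<in>?J. modular \<Omega> M (\<lambda>x. c * V \<gamma> x))"
    proof (rule sum_mono)
      fix \<alpha> assume "\<alpha> \<in> ?I"
      then have \<alpha>: "mi_order \<alpha> \<le> m" by simp
      have "modular \<Omega> M (\<lambda>x. 1 * V \<alpha> x) \<le> modular \<Omega> M (\<lambda>x. c * V (\<beta> \<alpha>) x)"
        using le[OF \<alpha>, of 1] by simp
      also have "\<dots> \<le> (\<Sum>\<gamma>\<in>?J. modular \<Omega> M (\<lambda>x. c * V \<gamma> x))"
        using \<beta>[OF \<alpha>] fin by (intro member_le_sum) auto
      finally show "modular \<Omega> M (\<lambda>x. 1 * V \<alpha> x) \<le> (\<Sum>\<gamma>\<in>?J. modular \<Omega> M (\<lambda>x. c * V \<gamma> x))" .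
    qed
    also have "\<dots> = (\<Sum>\<gamma>\<in>?J. ennreal (real N) * modular \<Omega> M (\<lambda>x. c * V \<gamma> x))"
      by (simp add: N_def sum_distrib_left ennreal_of_nat_eq_real_of_nat)
    also have "\<dots> \<le> (\<Sum>\<gamma>\<in>?J. modular \<Omega> M (\<lambda>x. real N * (c * V \<gamma> x)))"
      using N by (intro sum_mono modular_scale_ge phi borel_measurable_times borel_measurable_const
          E_space_measurable[OF V(1)]) auto
    also have "\<dots> = (\<integral>\<^sup>+x. ennreal (\<Sum>\<alpha>\<in>?J. M x (real N * c * \<bar>weak_deriv \<Omega> \<alpha> u x\<bar>)) \<partial>lebesgue_on \<Omega>)"
      unfolding mult.assoc[symmetric] using c
      by (intro nn_integral_sum_modular[symmetric] phi fin V) auto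
    finally show "(\<integral>\<^sup>+x. ennreal (\<Sum>\<alpha>\<in>?I. M x \<bar>weak_deriv \<Omega> \<alpha> u x\<bar>) \<partial>lebesgue_on \<Omega>)
      \<le> (\<integral>\<^sup>+x. ennreal (\<Sum>\<alpha>\<in>?J. M x (real N * c * \<bar>weak_deriv \<Omega> \<alpha> u x\<bar>)) \<partial>lebesgue_on \<Omega>)"
      by simp
    have lux: "luxemburg_norm \<Omega> M (weak_deriv \<Omega> \<alpha> u) = luxemburg_norm \<Omega> M (V \<alpha>)" if "mi_order \<alpha> \<le> m" for \<alpha>
      by (rule luxemburg_norm_cong_AE[OF V(2)[OF that]])
    have "(\<Sum>\<alpha>\<in>?I. luxemburg_norm \<Omega> M (V \<alpha>)) \<le> (\<Sum>\<alpha>\<in>?I. c * (\<Sum>\<gamma>\<in>?J. luxemburg_norm \<Omega> M (V \<gamma>)))"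
    proof (rule sum_mono)
      fix \<alpha> assume "\<alpha> \<in> ?I"
      then have \<alpha>: "mi_order \<alpha> \<le> m" by simp
      have "luxemburg_norm \<Omega> M (V \<alpha>) \<le> c * luxemburg_norm \<Omega> M (V (\<beta> \<alpha>))"
        using \<beta>[OF \<alpha>] by (intro luxemburg_norm_le phi V c le[OF \<alpha>]) auto
      also have "\<dots> \<le> c * (\<Sum>\<gamma>\<in>?J. luxemburg_norm \<Omega> M (V \<gamma>))"
        using \<beta>[OF \<alpha>] fin c
        by (intro mult_left_mono member_le_sum luxemburg_norm_nonneg phi V) auto
      finally show "luxemburg_norm \<Omega> M (V \<alpha>) \<le> c * (\<Sum>\<gamma>\<in>?J. luxemburg_norm \<Omega> M (V \<gamma>))" .
    qed
    then show "(\<Sum>\<alpha>\<in>?I. luxemburg_norm \<Omega> M (weak_deriv \<Omega> \<alpha> u))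
      \<le> real N * c * (\<Sum>\<alpha>\<in>?J. luxemburg_norm \<Omega> M (weak_deriv \<Omega> \<alpha> u))"
      by (simp add: lux N_def mult.assoc)
  qed
  show ?thesis
  proof (intro conjI exI[of _ "real N * c"] allI impI ballI)
    show "real N * c > 0" using N c by simp
  qed (use first second in blast)+
qed

end
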